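(* Let $(X,\mathcal W)$ be a balayage space such that there is a strictly positive bounded function $w_0\in\mathcal W$, and let $(U_n)_{n\in\mathbb N}$ be an exhaustion of $X$ by relatively compact open sets. Then, for every $p\in\mathcal P(X)$, the following are equivalent: (1) $K_p$ is a compact operator on $(\mathcal B_b(X),\|\cdot\|_\infty)$ (and $K_p(\mathcal B_b(X))\subset\mathcal C_b(X)$). (2) $\lim_{n\to\infty}\|K_p1_{X\setminus U_n}\|_\infty=0$.
   Context: $X$ is a locally compact space with countable base. $\mathcal B(X)$ is the set of all Borel measurable numerical (i.e. $[-\infty,\infty]$-valued) functions on $X$, $\mathcal C(X)$ is the set of all continuous real functions on $X$, and $\mathcal C_0(X)$ is the set of functions in $\mathcal C(X)$ vanishing at infinity. For a set $\mathcal F$ of functions, $\mathcal F_b$ and $\mathcal F^+$ denote its bounded, respectively positive ($\ge 0$), elements. An exhaustion of $X$ by relatively compact open sets is a sequence of relatively compact open sets $U_n$ with $\overline{U}_n\subset U_{n+1}$ and $\bigcup_nU_n=X$. $1_A$ is the indicator function of $A$, and $\|g\|_\infty=\sup|g|$ (possibly $\infty$). The inclusion in parentheses in (1) is an additional property that holds automatically when $K_p$ is a compact operator on $\mathcal B_b(X)$, so (1) may be read with or without it. Balayage space: $(X,\mathcal W)$ is a balayage space if $\mathcal W$ is a convex cone of positive numerical functions on $X$ such that: (B$_0$) (C) every $w\in\mathcal W$ is the supremum of its minorants in $\mathcal W\cap\mathcal C(X)$; (S) for all $x\ne y$ in $X$ and $\gamma>0$ there is $v\in\mathcal W$ with $v(x)\neq\gamma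 v(y)$; (T) there are strictly positive $u,v\in\mathcal W\cap\mathcal C(X)$ with $u/v\in\mathcal C_0(X)$. (B$_1$) If $v_n\in\mathcal W$ and $v_n\uparrow v$, then $v\in\mathcal W$. (B$_2$) If $\mathcal V\subset\mathcal W$, then $\widehat{\inf\mathcal V}^f\in\mathcal W$, where $\hat g^f$ is the greatest finely lower semicontinuous minorant of $g$ and the fine topology is the coarsest topology on $X$ for which all functions in $\mathcal W$ are continuous. (B$_3$) If $u,v',v''\in\mathcal W$ and $u\le v'+v''$, then there exist $u',u''\in\mathcal W$ with $u=u'+u''$, $u'\le v'$, $u''\le v''$. Continuous real potentials: $\mathcal P(X)$ is the set of all $p\in\mathcal W\cap\mathcal C(X)$ for which there is a strictly positive $w\in\mathcal W\cap\mathcal C(X)$ with $p/w\in\mathcal C_0(X)$. Superharmonic support: for $p\in\mathcal P(X)$, $C(p)$ is the smallest closed set $C$ in $X$ such that $p=\inf\{w\in\mathcal W\colon w\ge p\text{ on }C\}$ (it exists). Potential kernel: for $p\in\mathcal P(X)$, $K_p$ is the unique kernel on $X$ such that $K_p1=p$ and, for every $f\in\mathcal B_b^+(X)$, $K_pf\in\mathcal P(X)$ and $C(K_pf)\subset\operatorname{supp}(f)$. *)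

theory Defs
  imports "HOL-Analysis.Analysis"
begin

text \<open>Numerical functions have type \<^typ>\<open>'a \<Rightarrow> ereal\<close>; functions that are real by definition
  (continuous functions, bounded functions, continuous potentials) have type
  \<^typ>\<open>'a \<Rightarrow> real\<close> and are embedded by \<^const>\<open>ereal\<close> where they are compared with
  numerical functions.\<close>

subsection \<open>Function spaces\<close>

definition C0 :: "('a::topological_space \<Rightarrow> real) set" where
  "C0 = {f. continuous_on UNIV f \<and> (\<forall>e>0. \<exists>K. compact K \<and> (\<forall>x. x \<notin> K \<longrightarrow> \<bar>f x\<bar> < e))}"

definition Cb :: "('a::topological_space \<Rightarrow> real) set" where
  "Cb = {f. continuous_on UNIV f \<and> bounded (range f)}"

definition Bb :: "('a::topological_space \<Rightarrow> real) set" where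
  "Bb = {f \<in> borel_measurable borel. bounded (range f)}"

definition sup_norm :: "('a \<Rightarrow> real) \<Rightarrow> ereal" where
  "sup_norm f = (SUP x. ereal \<bar>f x\<bar>)"

definition sup_dist :: "('a \<Rightarrow> real) \<Rightarrow> ('a \<Rightarrow> real) \<Rightarrow> real" where
  "sup_dist f g = real_of_ereal (sup_norm (\<lambda>x. f x - g x))"

text \<open>On bounded functions \<^const>\<open>sup_norm\<close> is finite, so \<^const>\<open>sup_dist\<close> is the
  metric induced by the norm.\<close>

lemma sup_norm_nonneg: "0 \<le> sup_norm f"
  unfolding sup_norm_def by (rule SUP_upper2[of undefined]) auto

lemma sup_norm_le_iff: "sup_norm f \<le> ereal c \<longleftrightarrow> (\<forall>x. \<bar>f x\<bar> \<le> c)"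
  by (simp add: sup_norm_def SUP_le_iff)

lemma sup_norm_diff_finite:
  assumes "f \<in> Bb" "g \<in> Bb"
  shows "ereal (sup_dist f g) = sup_norm (\<lambda>x. f x - g x)"
proof -
  obtain a where a: "\<And>x. \<bar>f x\<bar> \<le> a"
    using assms(1) by (auto simp: Bb_def bounded_iff)
  obtain b where b: "\<And>x. \<bar>g x\<bar> \<le> b"
    using assms(2) by (auto simp: Bb_def bounded_iff)
  have "\<bar>f x - g x\<bar> \<le> a + b" for x
    using a[of x] b[of x] by linarith
  then have "sup_norm (\<lambda>x. f x - g x) \<le> ereal (a + b)"
    by (subst sup_norm_le_iff) blast
  then show ?thesis
    using sup_norm_nonneg[of "\<lambda>x. f x - g x"] unfolding sup_dist_def
    by (cases "sup_norm (\<lambda>x. f x - g x)") auto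
qed

lemma sup_dist_le_iff:
  assumes "f \<in> Bb" "g \<in> Bb"
  shows "sup_dist f g \<le> c \<longleftrightarrow> (\<forall>x. \<bar>f x - g x\<bar> \<le> c)"
  using sup_norm_diff_finite[OF assms] sup_norm_le_iff[of "\<lambda>x. f x - g x" c]
  by (metis ereal_less_eq(3))

lemma Metric_space_Bb: "Metric_space Bb sup_dist"
proof
  fix f g h :: "'a \<Rightarrow> real"
  show "0 \<le> sup_dist f g"
    by (simp add: sup_dist_def real_of_ereal_pos sup_norm_nonneg)
  show "sup_dist f g = sup_dist g f"
    by (simp add: sup_dist_def sup_norm_def abs_minus_commute)
  assume f: "f \<in> Bb" and g: "g \<in> Bb"
  show "sup_dist f g = 0 \<longleftrightarrow> f = g"
    using sup_dist_le_iff[OF f g, of 0] \<open>0 \<le> sup_dist f g\<close> by (auto simp: fun_eq_iff)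
  assume h: "h \<in> Bb"
  have "\<bar>f x - h x\<bar> \<le> sup_dist f g + sup_dist g h" for x
  proof -
    have "\<bar>f x - g x\<bar> \<le> sup_dist f g" "\<bar>g x - h x\<bar> \<le> sup_dist g h"
      using sup_dist_le_iff[OF f g] sup_dist_le_iff[OF g h] by blast+
    then show ?thesis by linarith
  qed
  then show "sup_dist f h \<le> sup_dist f g + sup_dist g h"
    by (simp add: sup_dist_le_iff[OF f h])
qed

definition compact_operator_Bb ::
  "(('a::topological_space \<Rightarrow> real) \<Rightarrow> ('a \<Rightarrow> real)) \<Rightarrow> bool" where
  "compact_operator_Bb T \<longleftrightarrow>
     T ` Bb \<subseteq> Bb \<and>
     (\<forall>f\<in>Bb. \<forall>g\<in>Bb. T (\<lambda>x. f x + g x) = (\<lambda>x. T f x + T g x)) \<and>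
     (\<forall>f\<in>Bb. \<forall>c. T (\<lambda>x. c * f x) = (\<lambda>x. c * T f x)) \<and>
     compactin (Metric_space.mtopology Bb sup_dist)
       (Metric_space.mtopology Bb sup_dist closure_of (T ` {f \<in> Bb. sup_norm f \<le> 1}))"

definition is_exhaustion :: "(nat \<Rightarrow> 'a::topological_space set) \<Rightarrow> bool" where
  "is_exhaustion U \<longleftrightarrow>
     (\<forall>n. open (U n) \<and> compact (closure (U n)) \<and> closure (U n) \<subseteq> U (Suc n)) \<and> (\<Union>n. U n) = UNIV"

subsection \<open>Fine topology\<close>

definition fine_topology :: "('a \<Rightarrow> ereal) set \<Rightarrow> 'a topology" where
  "fine_topology W = topology_generated_by {w -` V | w V. w \<in> W \<and> open V}"

lemma fine_topology_continuous:
  assumes "w \<in> W"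
  shows "continuous_map (fine_topology W) euclidean w"
proof -
  have "openin (fine_topology W) (w -` V)" if "open V" for V
    unfolding fine_topology_def
    by (rule topology_generated_by_Basis) (use assms that in blast)
  moreover from this[of UNIV] have "topspace (fine_topology W) = UNIV"
    using openin_subset by fastforce
  ultimately show ?thesis
    by (auto simp: continuous_map_def vimage_def)
qed

lemma fine_topology_coarsest:
  assumes "topspace T = UNIV" "\<And>w. w \<in> W \<Longrightarrow> continuous_map T euclidean w"
    and "openin (fine_topology W) S"
  shows "openin T S"
proof -
  have "generate_topology_on {w -` V | w V. w \<in> W \<and> open V} S"
    using assms(3) by (simp add: fine_topology_def openin_topology_generated_by_iff)
  then show ?thesis
  proof induction
    case (Basis s)
    then obtain w V where "s = w -` V" "w \<in> W" "open V" by blast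
    then show ?case
      using assms(1) assms(2)[of w] by (auto simp: continuous_map_def vimage_def)
  qed auto
qed

definition finely_lsc :: "('a \<Rightarrow> ereal) set \<Rightarrow> ('a \<Rightarrow> ereal) \<Rightarrow> bool" where
  "finely_lsc W g \<longleftrightarrow> (\<forall>a. openin (fine_topology W) {x. a < g x})"

definition fine_lsc_regularization ::
  "('a \<Rightarrow> ereal) set \<Rightarrow> ('a \<Rightarrow> ereal) \<Rightarrow> ('a \<Rightarrow> ereal)" where
  "fine_lsc_regularization W g = (GREATEST h. finely_lsc W h \<and> h \<le> g)"

text \<open>The greatest finely lower semicontinuous minorant exists.\<close>

lemma fine_lsc_regularization_eq:
  "fine_lsc_regularization W g = Sup {h. finely_lsc W h \<and> h \<le> g}"
  unfolding fine_lsc_regularization_def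
proof (rule Greatest_equality)
  let ?H = "{h. finely_lsc W h \<and> h \<le> g}"
  have "{x. a < Sup ?H x} = (\<Union>h\<in>?H. {x. a < h x})" for a
    by (auto simp: less_SUP_iff)
  moreover have "openin (fine_topology W) (\<Union>h\<in>?H. {x. a < h x})" for a
    by (rule openin_Union) (auto simp: finely_lsc_def)
  ultimately show "finely_lsc W (Sup ?H) \<and> Sup ?H \<le> g"
    unfolding finely_lsc_def by (auto intro!: Sup_least simp del: Sup_apply SUP_apply)
  show "h \<le> Sup ?H" if "finely_lsc W h \<and> h \<le> g" for h
    using that by (auto intro: Sup_upper)
qed

subsection \<open>Balayage spaces\<close>

text \<open>The real functions whose embedding is in \<open>W\<close> and which are continuous: the intersection
  of \<open>W\<close> with the space of continuous real functions.\<close>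

definition cont_part :: "('a::topological_space \<Rightarrow> ereal) set \<Rightarrow> ('a \<Rightarrow> real) set" where
  "cont_part W = {f. continuous_on UNIV f \<and> (\<lambda>x. ereal (f x)) \<in> W}"

locale balayage_space =
  fixes W :: "('a::{t2_space, second_countable_topology} \<Rightarrow> ereal) set"
  assumes locally_compact: "locally_compact_space (euclidean :: 'a topology)"
    and nonneg: "\<And>w x. w \<in> W \<Longrightarrow> 0 \<le> w x"
    and nonempty: "W \<noteq> {}"
    and cone_add: "\<And>v w. v \<in> W \<Longrightarrow> w \<in> W \<Longrightarrow> (\<lambda>x. v x + w x) \<in> W"
    and cone_scale: "\<And>(c::real) w. 0 \<le> c \<Longrightarrow> w \<in> W \<Longrightarrow> (\<lambda>x. ereal c * w x) \<in> W"
    and B0_C: "\<And>w x. w \<in> W \<Longrightarrow>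
      w x = (SUP f \<in> {f \<in> cont_part W. \<forall>y. ereal (f y) \<le> w y}. ereal (f x))"
    and B0_S: "\<And>x y (\<gamma>::real). x \<noteq> y \<Longrightarrow> 0 < \<gamma> \<Longrightarrow> \<exists>v\<in>W. v x \<noteq> ereal \<gamma> * v y"
    and B0_T: "\<exists>u\<in>cont_part W. \<exists>v\<in>cont_part W.
      (\<forall>x. 0 < u x) \<and> (\<forall>x. 0 < v x) \<and> (\<lambda>x. u x / v x) \<in> C0"
    and B1: "\<And>v :: nat \<Rightarrow> 'a \<Rightarrow> ereal. (\<And>n. v n \<in> W) \<Longrightarrow> incseq v \<Longrightarrow> (\<lambda>x. SUP n. v n x) \<in> W"
    and B2: "\<And>V. V \<subseteq> W \<Longrightarrow> fine_lsc_regularization W (\<lambda>x. INF v\<in>V. v x) \<in> W"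
    and B3: "\<And>u v' v''. u \<in> W \<Longrightarrow> v' \<in> W \<Longrightarrow> v'' \<in> W \<Longrightarrow> (\<forall>x. u x \<le> v' x + v'' x) \<Longrightarrow>
      \<exists>u'\<in>W. \<exists>u''\<in>W. (\<forall>x. u x = u' x + u'' x) \<and> (\<forall>x. u' x \<le> v' x) \<and> (\<forall>x. u'' x \<le> v'' x)"

definition potentials :: "('a::topological_space \<Rightarrow> ereal) set \<Rightarrow> ('a \<Rightarrow> real) set" where
  "potentials W =
     {p \<in> cont_part W. \<exists>w\<in>cont_part W. (\<forall>x. 0 < w x) \<and> (\<lambda>x. p x / w x) \<in> C0}"

definition determined_on ::
  "('a \<Rightarrow> ereal) set \<Rightarrow> ('a \<Rightarrow> real) \<Rightarrow> 'a set \<Rightarrow> bool" where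
  "determined_on W p C \<longleftrightarrow>
     (\<forall>x. ereal (p x) = (INF w \<in> {w \<in> W. \<forall>y\<in>C. ereal (p y) \<le> w y}. w x))"

text \<open>\<open>is_superharmonic_support W p C\<close> says that \<open>C\<close> is the superharmonic support of \<open>p\<close>.\<close>

definition is_superharmonic_support ::
  "('a::topological_space \<Rightarrow> ereal) set \<Rightarrow> ('a \<Rightarrow> real) \<Rightarrow> 'a set \<Rightarrow> bool" where
  "is_superharmonic_support W p C \<longleftrightarrow>
     closed C \<and> determined_on W p C \<and> (\<forall>D. closed D \<and> determined_on W p D \<longrightarrow> C \<subseteq> D)"

subsection \<open>Potential kernels\<close>

definition is_kernel :: "('a::topological_space \<Rightarrow> 'a measure) \<Rightarrow> bool" where
  "is_kernel K \<longleftrightarrow> (\<forall>x. sets (K x) = sets borel) \<and>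
     (\<forall>A\<in>sets borel. (\<lambda>x. emeasure (K x) A) \<in> borel_measurable borel)"

definition kernel_op :: "('a \<Rightarrow> 'a measure) \<Rightarrow> ('a \<Rightarrow> real) \<Rightarrow> ('a \<Rightarrow> real)" where
  "kernel_op K f = (\<lambda>x. \<integral>y. f y \<partial>K x)"

text \<open>The condition \<open>K 1 = p\<close> is stated with \<^const>\<open>emeasure\<close>, so that all measures \<open>K x\<close> are
  finite and \<^const>\<open>kernel_op\<close> is a genuine integral on bounded Borel functions. Such a \<open>K\<close> is
  unique.\<close>

definition is_potential_kernel ::
  "('a::topological_space \<Rightarrow> ereal) set \<Rightarrow> ('a \<Rightarrow> real) \<Rightarrow> ('a \<Rightarrow> 'a measure) \<Rightarrow> bool" where
  "is_potential_kernel W p K \<longleftrightarrow>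
     is_kernel K \<and> (\<forall>x. emeasure (K x) UNIV = ennreal (p x)) \<and>
     (\<forall>f\<in>Bb. (\<forall>x. 0 \<le> f x) \<longrightarrow>
        kernel_op K f \<in> potentials W \<and>
        (\<exists>C. is_superharmonic_support W (kernel_op K f) C \<and> C \<subseteq> closure {x. f x \<noteq> 0}))"

end

theory Submission
  imports Defs "HOL-Complex_Analysis.Great_Picard"
begin

text \<open>If \<open>K\<close> is compact, a subsequence of the decreasing functions \<open>K 1\<^bsub>X - U n\<^esub>\<close>, which tend to \<open>0\<close>
  pointwise, converges uniformly, and by monotonicity so does the whole sequence.

  Conversely, let \<open>0 \<le> f j \<le> 1\<close>. The kernel maps bounded Borel functions to continuous ones,
  so all measures \<open>K x\<close> have densities with respect to one finite measure, and weak-star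
  compactness yields a subsequence for which \<open>h j = K (1\<^bsub>U n\<^esub> f j)\<close> converges pointwise for every
  \<open>n\<close>. Both \<open>h j\<close> and \<open>p - h j = K (1 - 1\<^bsub>U n\<^esub> f j)\<close> belong to \<open>W\<close>. The fine regularizations of
  the infima over \<open>j \<ge> k\<close> of these two sequences increase with \<open>k\<close>; the sum of the two limits
  belongs to \<open>W\<close> and equals \<open>p\<close> off a finely meager set, hence everywhere, since the fine topology
  is a Baire topology. As functions in \<open>W\<close> are lower semicontinuous, Dini's argument makes the
  convergence of \<open>h j\<close> uniform on the compact set \<open>closure (U n)\<close>. It is then uniform on
  the whole space, because this set carries the superharmonic support of \<open>h j\<close> and \<open>w0\<close> is bounded and
  has a positive lower bound there. The contribution of the complement of \<open>U n\<close> is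
  uniformly small by assumption.\<close>

subsection \<open>Weak-star sequential compactness\<close>

text \<open>Since all weights \<open>c k\<close> are strictly positive, a null set of the weighted
  sum of the \<open>N k\<close> is null for every single \<open>N k\<close>.\<close>

lemma countable_dominating_measure:
  fixes N :: "nat \<Rightarrow> 'a::topological_space measure"
  assumes "\<And>k. finite_measure (N k)" and sets_N: "\<And>k. sets (N k) = sets borel"
  obtains m :: "'a measure" where "finite_measure m" "sets m = sets borel"
    "\<And>A k. A \<in> sets borel \<Longrightarrow> emeasure m A = 0 \<Longrightarrow> emeasure (N k) A = 0"
proof -
  \<comment> \<open>With this weight the \<open>k\<close>-th summand has mass at most
    \<open>(1/2)^k\<close>, so the sum is finite; the added \<open>1\<close> keeps the denominator
    positive when \<open>N k\<close> vanishes.\<close>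
  define c where "c k = (1/2)^k / (1 + measure (N k) UNIV)" for k
  have c_pos: "0 < c k" for k
    by (simp add: c_def add_pos_nonneg)
  define \<mu> where "\<mu> A = (\<integral>\<^sup>+k. ennreal (c k) * emeasure (N k) A \<partial>count_space UNIV)" for A
  define m where "m = measure_of UNIV (sets borel) \<mu>"
  have sets_m: "sets m = sets borel"
    by (simp add: m_def sigma_algebra.sigma_sets_eq sets.sigma_algebra_axioms[of borel, simplified])
  have sp: "space m = UNIV"
    by (simp add: m_def)
  have em: "emeasure m A = \<mu> A" if "A \<in> sets borel" for A
  proof (rule emeasure_measure_of[OF m_def])
    show "positive (sets m) \<mu>"
      by (simp add: positive_def \<mu>_def)
    show "countably_additive (sets m) \<mu>"
    proof (rule countably_additiveI)
      fix A :: "nat \<Rightarrow> 'a set"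
      assume A: "range A \<subseteq> sets m" and d: "disjoint_family A"
      have "(\<Sum>i. \<mu> (A i)) = (\<integral>\<^sup>+k. (\<Sum>i. ennreal (c k) * emeasure (N k) (A i)) \<partial>count_space UNIV)"
        unfolding \<mu>_def by (subst nn_integral_suminf) auto
      also have "\<dots> = \<mu> (\<Union>i. A i)"
        unfolding \<mu>_def
      proof (rule nn_integral_cong)
        fix k
        show "(\<Sum>i. ennreal (c k) * emeasure (N k) (A i)) = ennreal (c k) * emeasure (N k) (\<Union>i. A i)"
          using A d sets_m sets_N by (subst ennreal_suminf_cmult) (simp add: suminf_emeasure)
      qed
      finally show "(\<Sum>i. \<mu> (A i)) = \<mu> (\<Union>i. A i)" .
    qed
  qed (use that sets_m in auto)
  have "\<mu> UNIV \<le> (\<integral>\<^sup>+k. ennreal ((1/2)^k) \<partial>count_space UNIV)"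
    unfolding \<mu>_def
  proof (rule nn_integral_mono)
    fix k
    interpret finite_measure "N k" by fact
    have "c k * measure (N k) UNIV \<le> (1/2)^k"
      using measure_nonneg[of "N k" UNIV] by (simp add: c_def field_simps add_pos_nonneg)
    then show "ennreal (c k) * emeasure (N k) UNIV \<le> ennreal ((1/2)^k)"
      using c_pos[of k] by (simp add: emeasure_eq_measure ennreal_mult[symmetric] less_imp_le ennreal_leI)
  qed
  also have "\<dots> = (\<Sum>k. ennreal ((1/2)^k))"
    by (rule nn_integral_count_space_nat)
  also have "\<dots> = ennreal (\<Sum>k. (1/2)^k)"
    by (rule suminf_ennreal2) (auto intro: summable_geometric)
  finally have "emeasure m (space m) \<noteq> \<infinity>"
    using em[of UNIV] by (auto simp: sp top_unique)
  then have "finite_measure m"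
    by (rule finite_measureI)
  moreover have "emeasure (N k) A = 0" if "A \<in> sets borel" "emeasure m A = 0" for A k
    using that c_pos[of k] by (auto simp: em \<mu>_def nn_integral_0_iff_AE AE_count_space less_imp_le
        dest!: spec[of _ k])
  ultimately show ?thesis
    using sets_m that by blast
qed

lemma integrable_mult_unit_bounded:
  fixes f g :: "'a \<Rightarrow> real"
  assumes "integrable M g" "f \<in> borel_measurable M" "\<And>x. \<bar>f x\<bar> \<le> 1"
  shows "integrable M (\<lambda>x. g x * f x)"
proof (rule Bochner_Integration.integrable_bound[OF assms(1)])
  show "AE x in M. norm (g x * f x) \<le> norm (g x)"
    using assms(3) by (auto simp: abs_mult mult_left_le)
qed (use assms in measurable)

text \<open>By dominated convergence \<open>s i\<close> tends to \<open>g\<close> in L1. As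
  \<open>f j\<close> is bounded by 1, the integrals against \<open>s i\<close> approximate those
  against \<open>g\<close> uniformly in \<open>j\<close>, so the Cauchy property in \<open>j\<close>
  is inherited.\<close>

lemma convergent_integral_dominated:
  fixes f :: "nat \<Rightarrow> 'a \<Rightarrow> real" and g w :: "'a \<Rightarrow> real"
  assumes f: "\<And>j. f j \<in> borel_measurable M" "\<And>j x. \<bar>f j x\<bar> \<le> 1"
    and s: "\<And>i. integrable M (s i)" "\<And>i. convergent (\<lambda>j. \<integral>x. s i x * f j x \<partial>M)"
    and lim: "\<And>x. x \<in> space M \<Longrightarrow> (\<lambda>i. s i x) \<longlonglongrightarrow> g x"
    and g: "integrable M g"
    and w: "integrable M w" "\<And>i x. x \<in> space M \<Longrightarrow> \<bar>s i x\<bar> \<le> w x"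
  shows "convergent (\<lambda>j. \<integral>x. g x * f j x \<partial>M)"
proof -
  have "(\<lambda>i. \<integral>x. \<bar>s i x - g x\<bar> \<partial>M) \<longlonglongrightarrow> (\<integral>x. 0 \<partial>M)"
  proof (rule integral_dominated_convergence)
    show "integrable M (\<lambda>x. w x + \<bar>g x\<bar>)"
      using w g by auto
    show "AE x in M. (\<lambda>i. \<bar>s i x - g x\<bar>) \<longlonglongrightarrow> 0"
    proof (rule AE_I2)
      fix x assume "x \<in> space M"
      from tendsto_rabs[OF tendsto_diff[OF lim[OF this] tendsto_const[of "g x"]]]
      show "(\<lambda>i. \<bar>s i x - g x\<bar>) \<longlonglongrightarrow> 0" by simp
    qed
    show "AE x in M. norm \<bar>s i x - g x\<bar> \<le> w x + \<bar>g x\<bar>" for i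
    proof (rule AE_I2)
      fix x assume "x \<in> space M"
      from w(2)[OF this, of i] show "norm \<bar>s i x - g x\<bar> \<le> w x + \<bar>g x\<bar>" by simp
    qed
  qed (use s(1) g in measurable)
  then have L1: "(\<lambda>i. \<integral>x. \<bar>s i x - g x\<bar> \<partial>M) \<longlonglongrightarrow> 0" by simp
  have diff: "\<bar>(\<integral>x. s i x * f j x \<partial>M) - (\<integral>x. g x * f j x \<partial>M)\<bar> \<le> (\<integral>x. \<bar>s i x - g x\<bar> \<partial>M)" for i j
  proof -
    have "(\<integral>x. s i x * f j x \<partial>M) - (\<integral>x. g x * f j x \<partial>M) = (\<integral>x. (s i x - g x) * f j x \<partial>M)"
      using integrable_mult_unit_bounded[OF s(1) f] integrable_mult_unit_bounded[OF g f]
      by (simp add: left_diff_distrib)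
    also have "\<bar>\<dots>\<bar> \<le> (\<integral>x. \<bar>(s i x - g x) * f j x\<bar> \<partial>M)"
      by (rule integral_abs_bound)
    also have "\<dots> \<le> (\<integral>x. \<bar>s i x - g x\<bar> \<partial>M)"
    proof (rule integral_mono)
      show "integrable M (\<lambda>x. \<bar>(s i x - g x) * f j x\<bar>)"
        using integrable_mult_unit_bounded[OF _ f] s(1) g by auto
      show "\<bar>(s i x - g x) * f j x\<bar> \<le> \<bar>s i x - g x\<bar>" for x
        using f(2) by (simp add: abs_mult mult_left_le)
    qed (use s(1) g in auto)
    finally show ?thesis .
  qed
  have "Cauchy (\<lambda>j. \<integral>x. g x * f j x \<partial>M)"
  proof (rule metric_CauchyI)
    fix e :: real assume "0 < e"
    then have "eventually (\<lambda>i. (\<integral>x. \<bar>s i x - g x\<bar> \<partial>M) < e/3) sequentially"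
      by (intro order_tendstoD(2)[OF L1]) auto
    then obtain i where i: "(\<integral>x. \<bar>s i x - g x\<bar> \<partial>M) < e/3"
      by (auto simp: eventually_sequentially)
    have "Cauchy (\<lambda>j. \<integral>x. s i x * f j x \<partial>M)"
      using s(2) by (rule convergent_Cauchy)
    from metric_CauchyD[OF this, of "e/3"] \<open>0 < e\<close>
    obtain N where N: "\<And>a b. a \<ge> N \<Longrightarrow> b \<ge> N \<Longrightarrow>
        dist (\<integral>x. s i x * f a x \<partial>M) (\<integral>x. s i x * f b x \<partial>M) < e/3"
      by (meson divide_pos_pos zero_less_numeral)
    show "\<exists>N. \<forall>a\<ge>N. \<forall>b\<ge>N. dist (\<integral>x. g x * f a x \<partial>M) (\<integral>x. g x * f b x \<partial>M) < e"
    proof (intro exI allI impI)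
      fix a b assume "a \<ge> N" "b \<ge> N"
      from N[OF this] diff[of i a] diff[of i b] i
      show "dist (\<integral>x. g x * f a x \<partial>M) (\<integral>x. g x * f b x \<partial>M) < e"
        unfolding dist_real_def by linarith
    qed
  qed
  then show ?thesis
    by (rule Cauchy_convergent)
qed

text \<open>Sequential Banach-Alaoglu for the unit ball of the dual of L1. A diagonal subsequence
  converges against the indicators of a countable generator of the Borel sets; Dynkin's argument
  extends this to all Borel sets, and \<open>integrable_induct\<close> to all integrable
  functions.\<close>

lemma weak_star_convergent_subsequence:
  fixes f :: "nat \<Rightarrow> 'a::second_countable_topology \<Rightarrow> real"
  assumes "finite_measure M" and sets_M: "sets M = sets borel"
    and f: "\<And>j. f j \<in> borel_measurable borel" and f_le: "\<And>j x. \<bar>f j x\<bar> \<le> 1"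
  obtains r :: "nat \<Rightarrow> nat" where "strict_mono r"
    "\<And>g. integrable M g \<Longrightarrow> convergent (\<lambda>j. \<integral>x. g x * f (r j) x \<partial>M)"
proof -
  interpret finite_measure M by fact
  have [measurable_cong]: "sets M = sets borel" by fact
  have sp: "space M = UNIV"
    using sets_eq_imp_space_eq[OF sets_M] by simp
  have fM: "f j \<in> borel_measurable M" for j
    using f by measurable
  obtain B :: "'a set set" where B: "countable B" "topological_basis B"
    using ex_countable_basis by blast
  \<comment> \<open>Closing the base under finite intersections keeps it countable and yields the
    intersection-stable generator that Dynkin's argument needs. The empty intersection contributes
    \<open>UNIV\<close>, which serves the complement step.\<close>
  define I where "I = Inter ` {F. finite F \<and> F \<subseteq> B}"
  have I: "countable I"
    unfolding I_def using B(1) by (intro countable_image countable_Collect_finite_subset)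
  have "topological_basis I"
    unfolding topological_basis_def
  proof (intro conjI ballI allI impI)
    fix S assume "S \<in> I"
    then show "open S"
      using topological_basis_open[OF B(2)] by (auto simp: I_def intro!: open_Inter)
  next
    have "B \<subseteq> I"
      by (force simp: I_def intro: rev_image_eqI[of "{_}"])
    fix S :: "'a set" assume "open S"
    then obtain B' where "B' \<subseteq> B" "\<Union>B' = S"
      using B(2) by (auto simp: topological_basis_def)
    then show "\<exists>B'\<subseteq>I. \<Union>B' = S"
      using \<open>B \<subseteq> I\<close> by blast
  qed
  then have sets_I: "sets borel = sigma_sets UNIV I"
    by (subst borel_eq_countable_basis[OF I]) (auto simp: sets_measure_of)
  have Int_I: "Int_stable I"
  proof (rule Int_stableI)
    fix a b assume "a \<in> I" "b \<in> I"
    then obtain F G where "finite F" "F \<subseteq> B" "a = \<Inter>F" "finite G" "G \<subseteq> B" "b = \<Inter>G"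
      by (auto simp: I_def)
    then show "a \<inter> b \<in> I"
      by (auto simp: I_def intro!: rev_image_eqI[of "F \<union> G"])
  qed
  have UNIV_I: "UNIV \<in> I"
    by (auto simp: I_def intro!: rev_image_eqI[of "{}"])
  have bound: "norm (\<integral>x. indicator A x * f j x \<partial>M) \<le> measure M UNIV" if "A \<in> I" for A j
  proof -
    have A: "A \<in> sets M"
      using that sets_I sets_M by auto
    have int: "integrable M (\<lambda>x. indicator A x * f j x)"
      using A by (intro integrable_mult_unit_bounded fM f_le) (auto simp: emeasure_eq_measure)
    have "norm (\<integral>x. indicator A x * f j x \<partial>M) \<le> (\<integral>x. norm (indicator A x * f j x) \<partial>M)"
      by (rule integral_norm_bound)
    also have "\<dots> \<le> (\<integral>x. 1 \<partial>M)"
    proof (rule integral_mono)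
      show "norm (indicator A x * f j x) \<le> 1" for x
        using f_le[of j x] by (auto simp: indicator_def)
    qed (use int in auto)
    finally have "norm (\<integral>x. indicator A x * f j x \<partial>M) \<le> (\<integral>x. 1 \<partial>M)" .
    then show ?thesis by (simp add: sp)
  qed
  \<comment> \<open>Diagonalisation over the countable set \<open>I\<close>: each \<open>f j\<close>
    is viewed as a bounded function of the set \<open>A\<close>, namely the integral of
    \<open>f j\<close> over \<open>A\<close>.\<close>
  obtain r where r: "strict_mono (r :: nat \<Rightarrow> nat)"
    and conv_I: "\<And>A. A \<in> I \<Longrightarrow> \<exists>l. (\<lambda>j. \<integral>x. indicator A x * f (r j) x \<partial>M) \<longlonglongrightarrow> l"
    by (rule function_convergent_subsequence[OF I, of "\<lambda>j A. \<integral>x. indicator A x * f j x \<partial>M", OF bound]) blast+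
  define P where "P g \<longleftrightarrow> convergent (\<lambda>j. \<integral>x. g x * f (r j) x \<partial>M)" for g
  have P_add: "P (\<lambda>x. g x + h x)" if "P g" "P h" "integrable M g" "integrable M h" for g h
  proof -
    have "(\<integral>x. (g x + h x) * f (r j) x \<partial>M)
      = (\<integral>x. g x * f (r j) x \<partial>M) + (\<integral>x. h x * f (r j) x \<partial>M)" for j
      unfolding distrib_right
      by (intro Bochner_Integration.integral_add integrable_mult_unit_bounded that fM f_le)
    then show ?thesis
      using convergent_add[OF that(1,2)[unfolded P_def]] by (simp add: P_def)
  qed
  have P_cmult: "P (\<lambda>x. c * g x)" if "P g" for c g
    using convergent_mult[OF convergent_const[of c] that[unfolded P_def]]
    by (simp add: P_def mult.assoc)
  have ind: "integrable M (indicat_real A)" if "A \<in> sets borel" for A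
    using that by (auto simp: sets_M emeasure_eq_measure)
  note P_lim = convergent_integral_dominated[of "\<lambda>j. f (r j)", OF fM f_le, folded P_def]
  have P_ind: "P (indicat_real A)" if "A \<in> sets borel" for A
  proof -
    have sub: "I \<subseteq> Pow UNIV" by simp
    from that have A: "A \<in> sigma_sets UNIV I"
      by (simp add: sets_I)
    from Int_I sub A show ?thesis
    proof (induction rule: sigma_sets_induct_disjoint)
      case (basic A)
      then show ?case using conv_I by (auto simp: P_def convergent_def)
    next
      case empty
      then show ?case by (simp add: P_def convergent_const)
    next
      case (compl A)
      have "indicat_real (UNIV - A) = (\<lambda>x. indicator UNIV x + (-1) * indicator A x)"
        by (auto simp: indicator_def)
      moreover have "P (\<lambda>x. indicator UNIV x + (-1) * indicat_real A x)"
        using compl ind[of A] ind[of UNIV] conv_I[OF UNIV_I]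
        by (intro P_add P_cmult) (auto simp: P_def convergent_def sets_I)
      ultimately show ?case by simp
    next
      case (union A)
      then have A: "A i \<in> sets borel" for i
        by (auto simp: sets_I)
      have fin: "P (indicat_real (\<Union>i<n. A i))" for n
      proof (induction n)
        case 0
        then show ?case by (simp add: P_def convergent_const)
      next
        case (Suc n)
        have "A n \<inter> A i = {}" if "i < n" for i
          using union(1) that by (auto simp: disjoint_family_on_def)
        then have "indicat_real (\<Union>i<Suc n. A i)
          = (\<lambda>x. indicat_real (\<Union>i<n. A i) x + indicat_real (A n) x)"
          by (fastforce simp: indicator_def less_Suc_eq fun_eq_iff)
        moreover have "P (\<lambda>x. indicat_real (\<Union>i<n. A i) x + indicat_real (A n) x)"
          using A Suc union by (intro P_add ind) auto
        ultimately show ?case by simp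
      qed
      show ?case
      proof (rule P_lim[where s = "\<lambda>n. indicat_real (\<Union>i<n. A i)" and w = "\<lambda>_. 1"])
        show "(\<lambda>n. indicat_real (\<Union>i<n. A i) x) \<longlonglongrightarrow> indicat_real (\<Union>i. A i) x" for x
          by (rule LIMSEQ_indicator_UN)
        show "P (indicat_real (\<Union>i<n. A i))" for n
          by (rule fin)
        show "\<bar>indicat_real (\<Union>i<n. A i) x\<bar> \<le> 1" for n x
          by (simp add: indicator_def)
      qed (use A in \<open>auto intro!: ind\<close>)
    qed
  qed
  have "P g" if "integrable M g" for g
    using that
  proof (induction rule: integrable_induct)
    case (base A c)
    then show ?case
      using P_cmult[OF P_ind, of A c] by (simp add: sets_M mult.commute)
  next
    case (add g h)
    then show ?case by (intro P_add)
  next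
    case (lim g s)
    show ?case
    proof (rule P_lim)
      \<comment> \<open>The factor 2 is the bound that \<open>integrable_induct\<close> supplies for
        its approximating functions.\<close>
      show "\<bar>s i x\<bar> \<le> 2 * \<bar>g x\<bar>" if "x \<in> space M" for i x
        using lim(3)[OF that, of i] by simp
      show "integrable M (\<lambda>x. 2 * \<bar>g x\<bar>)"
        using lim(4) by simp
    qed (fact lim)+
  qed
  with r that show ?thesis
    unfolding P_def by blast
qed

text \<open>All measures \<open>K x\<close> are absolutely continuous with respect to a mixture of the measures
  belonging to a dense sequence, because null sets are detected on a dense set.\<close>

lemma strong_Feller_convergent_subsequence:
  fixes K :: "'a::second_countable_topology \<Rightarrow> 'a measure" and f :: "nat \<Rightarrow> 'a \<Rightarrow> real"
  assumes sets_K: "\<And>x. sets (K x) = sets borel" and fin: "\<And>x. finite_measure (K x)"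
    and cont: "\<And>A. A \<in> sets borel \<Longrightarrow> continuous_on UNIV (\<lambda>x. measure (K x) A)"
    and f: "\<And>j. f j \<in> borel_measurable borel" "\<And>j x. \<bar>f j x\<bar> \<le> 1"
  obtains r :: "nat \<Rightarrow> nat" where "strict_mono r"
    "\<And>x A. A \<in> sets borel \<Longrightarrow> convergent (\<lambda>j. \<integral>y. indicator A y * f (r j) y \<partial>K x)"
proof -
  obtain D :: "'a set" where D: "countable D" "\<And>X. open X \<Longrightarrow> X \<noteq> {} \<Longrightarrow> \<exists>d\<in>D. d \<in> X"
    using countable_dense_setE by metis
  have "D \<noteq> {}" using D(2)[of UNIV] by auto
  obtain m where m: "finite_measure m" "sets m = sets borel"
    "\<And>A k. A \<in> sets borel \<Longrightarrow> emeasure m A = 0 \<Longrightarrow> emeasure (K (from_nat_into D k)) A = 0"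
    by (rule countable_dominating_measure[of "\<lambda>k. K (from_nat_into D k)"]) (use sets_K fin in auto)
  interpret m: finite_measure m by fact
  have [measurable_cong]: "sets m = sets borel" by fact
  have ac: "absolutely_continuous m (K x)" for x
    unfolding absolutely_continuous_def
  proof
    fix A assume "A \<in> null_sets m"
    then have A: "A \<in> sets borel" "emeasure m A = 0" using m(2) by auto
    have "measure (K d) A = 0" if "d \<in> D" for d
    proof -
      obtain k where "d = from_nat_into D k"
        using from_nat_into_surj[OF D(1) \<open>d \<in> D\<close>] by blast
      then show ?thesis using m(3)[OF A, of k] by (simp add: measure_def)
    qed
    moreover have "open {x. measure (K x) A \<noteq> 0}"
      by (intro open_Collect_neq cont A continuous_on_const)
    ultimately have "{x. measure (K x) A \<noteq> 0} = {}"
      using D(2) by blast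
    then have "measure (K x) A = 0" by blast
    then show "A \<in> null_sets (K x)"
      using A(1) finite_measure.emeasure_eq_measure[OF fin] sets_K by auto
  qed
  obtain r where r: "strict_mono (r :: nat \<Rightarrow> nat)"
    "\<And>g. integrable m g \<Longrightarrow> convergent (\<lambda>j. \<integral>x. g x * f (r j) x \<partial>m)"
    by (rule weak_star_convergent_subsequence[of m f, OF m(1,2) f]) blast
  show ?thesis
  proof (rule that[OF r(1)])
    fix x and A :: "'a set" assume A[measurable]: "A \<in> sets borel"
    \<comment> \<open>With a real density \<open>g\<close> of \<open>K x\<close>, the integral over
      \<open>A\<close> against \<open>K x\<close> becomes an integral against \<open>m\<close> with
      the test function \<open>g * indicator A\<close>, which does not depend on
      \<open>j\<close>.\<close>
    obtain g where g[measurable]: "g \<in> borel_measurable m"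
      and RN: "AE y in m. RN_deriv m (K x) y = ennreal (g y)" and "\<And>y. 0 \<le> g y"
      by (rule m.real_RN_deriv[OF fin ac, of x]) (use sets_K m(2) in auto)
    have "K x = density m (RN_deriv m (K x))"
      using m.density_RN_deriv[OF ac, of x] sets_K m(2) by simp
    also have "\<dots> = density m (\<lambda>y. ennreal (g y))"
      by (rule density_cong) (use RN in auto)
    finally have K_eq: "K x = density m (\<lambda>y. ennreal (g y))" .
    have "(\<integral>\<^sup>+y. ennreal (g y) \<partial>m) = emeasure (K x) (space m)"
      unfolding K_eq by (subst emeasure_density) (auto simp: nn_integral_indicator intro!: nn_integral_cong)
    also have "\<dots> < \<infinity>"
      using finite_measure.emeasure_finite[OF fin] by (simp add: less_top[symmetric])
    finally have "integrable m g"
      by (intro integrableI_nonneg) (use \<open>\<And>y. 0 \<le> g y\<close> in auto)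
    then have int: "integrable m (\<lambda>y. g y * indicator A y)"
      by (intro integrable_mult_unit_bounded) (auto simp: indicator_def)
    have "(\<integral>y. indicator A y * f (r j) y \<partial>K x) = (\<integral>y. g y * indicator A y * f (r j) y \<partial>m)" for j
      unfolding K_eq using f(1) \<open>\<And>y. 0 \<le> g y\<close>
      by (subst integral_density) (auto simp: mult.assoc)
    then show "convergent (\<lambda>j. \<integral>y. indicator A y * f (r j) y \<partial>K x)"
      using r(2)[OF int] by simp
  qed
qed

subsection \<open>The fine topology\<close>

context balayage_space
begin

abbreviation fine_top :: "'a topology" where
  "fine_top \<equiv> fine_topology W"

lemma openin_fine_vimage: "w \<in> W \<Longrightarrow> open V \<Longrightarrow> openin fine_top (w -` V)"
  unfolding fine_topology_def by (rule topology_generated_by_Basis) blast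

lemma topspace_fine: "topspace fine_top = UNIV"
proof -
  obtain w where "w \<in> W" using nonempty by blast
  from openin_subset[OF openin_fine_vimage[OF this open_UNIV]] show ?thesis by auto
qed

lemma openin_fine_cont_vimage:
  assumes "f \<in> cont_part W" "open V"
  shows "openin fine_top {x. f x \<in> V}"
proof -
  have "{x. f x \<in> V} = (\<lambda>x. ereal (f x)) -` (ereal ` V)"
    by auto
  then show ?thesis
    using assms openin_fine_vimage[OF _ open_ereal[OF assms(2)], of "\<lambda>x. ereal (f x)"]
    by (simp add: cont_part_def)
qed

text \<open>A real number fits strictly between two distinct extended reals, so one-sided level sets
  suffice. The difference of \<open>f\<close> and \<open>g\<close> would cause trouble at infinite
  values.\<close>

lemma openin_fine_Collect_less:
  fixes f g :: "'a \<Rightarrow> ereal"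
  assumes "\<And>q::real. openin fine_top {x. f x < ereal q}" "\<And>q::real. openin fine_top {x. ereal q < g x}"
  shows "openin fine_top {x. f x < g x}"
proof -
  have "{x. f x < g x} = (\<Union>q::real. {x. f x < ereal q} \<inter> {x. ereal q < g x})"
    using ereal_dense2 by fastforce
  then show ?thesis
    using assms by (auto intro!: openin_Union openin_Int)
qed

lemma openin_fine_less_cmult:
  assumes "f \<in> cont_part W" "v \<in> cont_part W"
  shows "openin fine_top {x. f x < c * v x}" "openin fine_top {x. c * v x < f x}"
proof -
  have sub: "openin fine_top {x. f x \<in> {..<q}}" "openin fine_top {x. f x \<in> {q<..}}"
    "openin fine_top {x. v x \<in> {t. c * t < q}}" "openin fine_top {x. v x \<in> {t. q < c * t}}" for q
    by (rule openin_fine_cont_vimage; (fact | intro open_Collect_less continuous_intros | simp))+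
  have "openin fine_top {x. ereal (f x) < ereal (c * v x)}"
    by (rule openin_fine_Collect_less; use sub in simp)
  then show "openin fine_top {x. f x < c * v x}" by simp
  have "openin fine_top {x. ereal (c * v x) < ereal (f x)}"
    by (rule openin_fine_Collect_less; use sub in simp)
  then show "openin fine_top {x. c * v x < f x}" by simp
qed

lemma cont_part_nonneg: "f \<in> cont_part W \<Longrightarrow> 0 \<le> f x"
  using nonneg[of "\<lambda>x. ereal (f x)" x] by (simp add: cont_part_def)

text \<open>Axiom (S) yields a separating \<open>s\<close> in \<open>W\<close> that may be
  discontinuous or infinite. If all continuous members satisfied
  \<open>f x = \<gamma> * f y\<close>, then taking suprema over the minorants in (C) would give the
  same relation for \<open>s\<close>. With \<open>\<gamma>\<close> the ratio of the values of
  \<open>v\<close>, failure of this relation means that the quotients by \<open>v\<close>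
  differ.\<close>

lemma cont_part_separates:
  assumes "x \<noteq> y" "0 < v x" "0 < v y"
  obtains f where "f \<in> cont_part W" "f x / v x \<noteq> f y / v y"
proof -
  define \<gamma> where "\<gamma> = v x / v y"
  have "0 < \<gamma>" using assms by (simp add: \<gamma>_def)
  obtain s where s: "s \<in> W" "s x \<noteq> ereal \<gamma> * s y"
    using B0_S[OF assms(1) \<open>0 < \<gamma>\<close>] by blast
  have "\<exists>f\<in>cont_part W. f x \<noteq> \<gamma> * f y"
  proof (rule ccontr)
    let ?M = "{f \<in> cont_part W. \<forall>y. ereal (f y) \<le> s y}"
    assume "\<not> ?thesis"
    then have eq: "\<And>f. f \<in> cont_part W \<Longrightarrow> f x = \<gamma> * f y" by blast
    \<comment> \<open>The zero function makes the family of minorants nonempty, as required for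
      pulling \<open>\<gamma>\<close> out of the supremum.\<close>
    have zero: "(\<lambda>_. 0) \<in> ?M"
    proof -
      have "(\<lambda>x. ereal 0 * s x) \<in> W"
        by (rule cone_scale) (use s in auto)
      then show ?thesis
        using nonneg[OF s(1)] by (simp add: cont_part_def zero_ereal_def[symmetric])
    qed
    have "s x = (SUP f\<in>?M. ereal (f x))" by (rule B0_C[OF s(1)])
    also have "\<dots> = (SUP f\<in>?M. ereal \<gamma> * ereal (f y))"
      by (rule SUP_cong[OF refl]) (simp add: eq)
    also have "\<dots> = ereal \<gamma> * (SUP f\<in>?M. ereal (f y))"
    proof (rule SUP_ereal_mult_left)
      show "?M \<noteq> {}" using zero by blast
      show "0 \<le> ereal (f y)" if "f \<in> ?M" for f
        using that cont_part_nonneg by simp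
      show "0 \<le> ereal \<gamma>" using \<open>0 < \<gamma>\<close> by simp
    qed
    also have "\<dots> = ereal \<gamma> * s y" by (simp add: B0_C[OF s(1), of y])
    finally show False using s(2) by simp
  qed
  then obtain f where "f \<in> cont_part W" "f x \<noteq> \<gamma> * f y" by blast
  then show ?thesis
    using assms by (intro that[of f]) (auto simp: \<gamma>_def field_simps)
qed

text \<open>Quotients of functions in the continuous part separate points by (S) and (C), and one of
  them confines a neighbourhood to a compact set by (T).\<close>

lemma open_imp_openin_fine:
  assumes "open G"
  shows "openin fine_top G"
proof (subst openin_subopen, rule ballI)
  fix x assume "x \<in> G"
  obtain u v where u: "u \<in> cont_part W" and v: "v \<in> cont_part W"
    and pos: "\<And>x. 0 < u x" "\<And>x. 0 < v x" and uv: "(\<lambda>x. u x / v x) \<in> C0"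
    using B0_T by blast
  have v_cont: "continuous_on UNIV v" using v by (simp add: cont_part_def)
  \<comment> \<open>Half the value of \<open>u / v\<close> at \<open>x\<close>: the set where
    \<open>u / v\<close> exceeds \<open>c\<close> contains \<open>x\<close>, and it lies inside the
    compact set \<open>L\<close> outside which \<open>u / v\<close> is below
    \<open>c\<close>.\<close>
  define c where "c = u x / v x / 2"
  have "0 < c" using pos by (simp add: c_def)
  then obtain L where L: "compact L" "\<And>z. z \<notin> L \<Longrightarrow> \<bar>u z / v z\<bar> < c"
    using uv unfolding C0_def by blast
  have sep: "\<exists>H N. openin fine_top H \<and> x \<in> H \<and> open N \<and> y \<in> N \<and> H \<inter> N = {}" if "y \<noteq> x" for y
  proof -
    obtain f where f: "f \<in> cont_part W" and ne: "f x / v x \<noteq> f y / v y"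
      using cont_part_separates[of x y v] \<open>y \<noteq> x\<close> pos by metis
    have f_cont: "continuous_on UNIV f" using f by (simp add: cont_part_def)
    \<comment> \<open>The midpoint of the two distinct quotients: of the sets
      \<open>{f < d * v}\<close> and \<open>{d * v < f}\<close>, one contains \<open>x\<close> and
      the other \<open>y\<close>. Both are open and also finely open.\<close>
    define d where "d = (f x / v x + f y / v y) / 2"
    have "open {z. f z < d * v z}" "open {z. d * v z < f z}"
      by (intro open_Collect_less continuous_intros f_cont v_cont)+
    moreover note openin_fine_less_cmult[OF f v, of d]
    moreover have "(f x < d * v x \<and> d * v y < f y) \<or> (f y < d * v y \<and> d * v x < f x)"
    proof -
      have "f x / v x < d \<and> d < f y / v y \<or> f y / v y < d \<and> d < f x / v x"
        using ne unfolding d_def by argo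
      then show ?thesis
        using pos(2)[of x] pos(2)[of y] by (simp add: pos_divide_less_eq pos_less_divide_eq)
    qed
    ultimately show ?thesis
      by (elim disjE) (rule exI[of _ "{z. f z < d * v z}"], rule exI[of _ "{z. d * v z < f z}"], force,
        rule exI[of _ "{z. d * v z < f z}"], rule exI[of _ "{z. f z < d * v z}"], force)
  qed
  then obtain H N where HN: "\<And>y. y \<noteq> x \<Longrightarrow>
      openin fine_top (H y) \<and> x \<in> H y \<and> open (N y) \<and> y \<in> N y \<and> H y \<inter> N y = {}"
    by metis
  have "compact (L - G)" using L(1) assms by (rule compact_diff)
  then obtain C where C: "C \<subseteq> L - G" "finite C" "L - G \<subseteq> (\<Union>y\<in>C. N y)"
  proof (rule compactE_image)
    show "open (N y)" if "y \<in> L - G" for y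
      using HN[of y] that \<open>x \<in> G\<close> by blast
    show "L - G \<subseteq> (\<Union>y\<in>L - G. N y)"
    proof
      fix y assume y: "y \<in> L - G"
      then have "y \<in> N y" using HN[of y] \<open>x \<in> G\<close> by blast
      with y show "y \<in> (\<Union>y\<in>L - G. N y)" by blast
    qed
  qed
  have neq: "y \<noteq> x" if "y \<in> C" for y using that C(1) \<open>x \<in> G\<close> by blast
  \<comment> \<open>The first factor confines \<open>T\<close> to \<open>L\<close>, and the finitely
    many \<open>H y\<close> keep it away from \<open>L - G\<close>. The factor
    \<open>topspace fine_top\<close> covers the case that \<open>C\<close> is empty.\<close>
  define T where "T = {z. c * v z < u z} \<inter> ((\<Inter>y\<in>C. H y) \<inter> topspace fine_top)"
  have "openin fine_top T"
    unfolding T_def using HN neq C(2) openin_fine_less_cmult[OF u v]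
    by (intro openin_Int openin_INT) auto
  moreover have "x \<in> T"
    using HN neq pos[of x] by (auto simp: T_def topspace_fine c_def)
  moreover have "T \<subseteq> G"
  proof
    fix z assume z: "z \<in> T"
    have "z \<in> L"
    proof (rule ccontr)
      assume "z \<notin> L"
      from L(2)[OF this] have "u z / v z < c" by linarith
      then have "u z < c * v z" using pos(2)[of z] by (simp add: pos_divide_less_eq)
      with z show False by (simp add: T_def)
    qed
    show "z \<in> G"
    proof (rule ccontr)
      assume "z \<notin> G"
      with \<open>z \<in> L\<close> C(3) obtain y where y: "y \<in> C" "z \<in> N y" by blast
      with z HN[OF neq[OF y(1)]] show False by (auto simp: T_def)
    qed
  qed
  ultimately show "\<exists>T. openin fine_top T \<and> x \<in> T \<and> T \<subseteq> G" by blast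
qed

section \<open>Lower semicontinuity and compact fine neighbourhoods\<close>

text \<open>By (C), \<open>w\<close> is a supremum of continuous functions, hence lower
  semicontinuous. The bound is a continuous function instead of a constant because the Dini argument
  compares with \<open>p - e\<close>.\<close>

lemma open_Collect_less_superharmonic:
  assumes "w \<in> W" "continuous_on UNIV g"
  shows "open {x. ereal (g x) < w x}"
proof -
  have "{x. ereal (g x) < w x} = (\<Union>f\<in>{f \<in> cont_part W. \<forall>y. ereal (f y) \<le> w y}. {x. g x < f x})"
    by (subst B0_C[OF assms(1)]) (auto simp: less_SUP_iff)
  then show ?thesis
    using assms(2) by (auto simp: cont_part_def intro!: open_Collect_less)
qed

lemma closed_Collect_le_superharmonic: "w \<in> W \<Longrightarrow> closed {x. w x \<le> ereal c}"
  using open_Collect_less_superharmonic[of w "\<lambda>_. c"] by (simp add: closed_def Compl_eq not_le)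

lemma Hausdorff_euclidean: "Hausdorff_space (euclidean :: 'a topology)"
  unfolding Hausdorff_space_def disjnt_def using hausdorff by fastforce

lemma compact_neighbourhood:
  assumes "open G" "x \<in> (G :: 'a set)"
  obtains V L where "open V" "compact L" "x \<in> V" "V \<subseteq> L" "L \<subseteq> G"
proof -
  have "neighbourhood_base_of (compactin euclidean) (euclidean :: 'a topology)"
    using locally_compact Hausdorff_euclidean locally_compact_space_neighbourhood_base by blast
  then have "\<exists>V L. open V \<and> compact L \<and> x \<in> V \<and> V \<subseteq> L \<and> L \<subseteq> G"
    using assms unfolding neighbourhood_base_of by (simp only: open_openin[symmetric] compactin_euclidean_iff)
  then show ?thesis using that by blast
qed

text \<open>Functions in \<open>W\<close> are lower semicontinuous, so the fine neighbourhood
  \<open>{w < b}\<close> contains the closed fine neighbourhoods \<open>{w \<le> b'}\<close>, while \<open>{a < w}\<close> is open.\<close>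

lemma compact_fine_neighbourhood:
  assumes "openin fine_top G" "x \<in> G"
  shows "\<exists>V L. openin fine_top V \<and> compact L \<and> x \<in> V \<and> V \<subseteq> L \<and> L \<subseteq> G"
proof -
  have "generate_topology_on {w -` V | w V. w \<in> W \<and> open V} G"
    using assms(1) by (simp add: fine_topology_def openin_topology_generated_by_iff)
  then show ?thesis
    using assms(2)
  proof (induction arbitrary: x)
    case (Int A B)
    then have "x \<in> A" "x \<in> B" by auto
    obtain V L where "openin fine_top V" "compact L" "x \<in> V" "V \<subseteq> L" "L \<subseteq> A"
      using Int.IH(1)[OF \<open>x \<in> A\<close>] by blast
    moreover obtain V' L' where "openin fine_top V'" "compact L'" "x \<in> V'" "V' \<subseteq> L'" "L' \<subseteq> B"
      using Int.IH(2)[OF \<open>x \<in> B\<close>] by blast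
    ultimately show ?case
      by (intro exI[of _ "V \<inter> V'"] exI[of _ "L \<inter> L'"]) (auto intro: openin_Int compact_Int)
  next
    case (UN K)
    then obtain k where k: "k \<in> K" "x \<in> k" by blast
    from UN.IH[OF this] obtain V L where "openin fine_top V" "compact L" "x \<in> V" "V \<subseteq> L" "L \<subseteq> k"
      by blast
    then show ?case
      using k(1) by (intro exI[of _ V] exI[of _ L]) auto
  next
    case (Basis S)
    then obtain w V where w: "S = w -` V" "w \<in> W" "open V" by blast
    then have "w x \<in> V" using Basis by simp
    have "- \<infinity> < w x" using nonneg[OF w(2), of x] by auto
    then obtain a where a: "a < w x" "{a<..w x} \<subseteq> V"
      using open_left[OF \<open>open V\<close> \<open>w x \<in> V\<close>] by blast
    then obtain a' :: real where a': "a < ereal a'" "ereal a' < w x"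
      using ereal_dense2 by blast
    have "open {z. ereal a' < w z}"
      by (intro open_Collect_less_superharmonic continuous_on_const w)
    then obtain O1 L1 where 1: "open O1" "compact L1" "x \<in> O1" "O1 \<subseteq> L1" "L1 \<subseteq> {z. ereal a' < w z}"
      using compact_neighbourhood[of "{z. ereal a' < w z}" x] a'(2) by auto
    have "\<exists>O2 L2. openin fine_top O2 \<and> closed L2 \<and> x \<in> O2 \<and> O2 \<subseteq> L2 \<and>
        (\<forall>z\<in>L2. w x \<le> w z \<longrightarrow> w z \<in> V)"
    proof (cases "w x = \<infinity>")
      case True
      then show ?thesis
        using \<open>w x \<in> V\<close> by (intro exI[of _ UNIV]) (auto simp: open_imp_openin_fine)
    next
      case False
      then have "w x < \<infinity>" by simp
      then obtain b where b: "w x < b" "{w x..<b} \<subseteq> V"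
        using open_right[OF \<open>open V\<close> \<open>w x \<in> V\<close>] by blast
      then obtain b' :: real where b': "w x < ereal b'" "ereal b' < b"
        using ereal_dense2 by blast
      show ?thesis
      proof (intro exI conjI)
        show "openin fine_top (w -` {..<ereal b'})" by (intro openin_fine_vimage w) simp
        show "closed {z. w z \<le> ereal b'}" by (intro closed_Collect_le_superharmonic w)
        show "\<forall>z\<in>{z. w z \<le> ereal b'}. w x \<le> w z \<longrightarrow> w z \<in> V"
          using b(2) b'(2) by (auto simp: subset_iff intro: le_less_trans)
      qed (use b' in auto)
    qed
    then obtain O2 L2 where 2: "openin fine_top O2" "closed L2" "x \<in> O2" "O2 \<subseteq> L2"
      "\<And>z. z \<in> L2 \<Longrightarrow> w x \<le> w z \<Longrightarrow> w z \<in> V" by blast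
    \<comment> \<open>On \<open>L1\<close> the values stay above \<open>a\<close>, so those up to
      \<open>w x\<close> lie in \<open>V\<close>; the values beyond \<open>w x\<close> are handled
      by \<open>L2\<close>. Compactness comes from \<open>L1\<close>, while \<open>L2\<close> is
      merely closed in the original topology.\<close>
    have "L1 \<inter> L2 \<subseteq> S"
    proof
      fix z assume z: "z \<in> L1 \<inter> L2"
      then have "a < w z" using 1(5) a'(1) by (auto intro: less_trans)
      then have "w z \<in> V" using a(2) 2(5)[of z] z by (cases "w z \<le> w x") auto
      then show "z \<in> S" by (simp add: w(1))
    qed
    moreover have "openin fine_top (O1 \<inter> O2)"
      using 1 2 open_imp_openin_fine by (intro openin_Int) auto
    ultimately show ?case
      using 1 2 by (intro exI[of _ "O1 \<inter> O2"] exI[of _ "L1 \<inter> L2"]) (auto intro: compact_Int_closed)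
  qed auto
qed

section \<open>Baire property of the fine topology\<close>

definition fine_nowhere_dense :: "'a set \<Rightarrow> bool" where
  "fine_nowhere_dense F \<longleftrightarrow> closedin fine_top F \<and> (\<forall>V. openin fine_top V \<longrightarrow> V \<subseteq> F \<longrightarrow> V = {})"

text \<open>The classical nested-set proof, with interiors taken in the fine topology but
  compactness in the original one; \<open>compact_fine_neighbourhood\<close> links the two.\<close>

lemma fine_Baire:
  assumes "countable \<F>" "\<And>F. F \<in> \<F> \<Longrightarrow> fine_nowhere_dense F"
    and G: "openin fine_top G" "G \<subseteq> \<Union>\<F>"
  shows "G = {}"
proof (rule ccontr)
  assume "G \<noteq> {}"
  then have "\<F> \<noteq> {}" using G(2) by blast
  define F where "F = from_nat_into \<F>"
  have F: "fine_nowhere_dense (F n)" for n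
    using assms(2) from_nat_into[OF \<open>\<F> \<noteq> {}\<close>] by (simp add: F_def)
  have range_F: "range F = \<F>"
    unfolding F_def by (rule range_from_nat_into) fact+
  define fat where "fat L \<longleftrightarrow> compact L \<and> (\<exists>V. openin fine_top V \<and> V \<noteq> {} \<and> V \<subseteq> L)" for L
  have shrink: "\<exists>L. fat L \<and> L \<subseteq> V" if "openin fine_top V" "V \<noteq> {}" for V
  proof -
    obtain x where "x \<in> V" using \<open>V \<noteq> {}\<close> by blast
    from compact_fine_neighbourhood[OF that(1) this]
    obtain O' L where "openin fine_top O'" "compact L" "x \<in> O'" "O' \<subseteq> L" "L \<subseteq> V" by blast
    then show ?thesis unfolding fat_def by (intro exI[of _ L]) auto
  qed
  \<comment> \<open>Removing \<open>F n\<close> from a nonempty finely open subset of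
    \<open>L n\<close> leaves a nonempty finely open set, which contains the next fat compact
    set.\<close>
  have "\<exists>L. \<forall>n. (fat (L n) \<and> L n \<subseteq> G) \<and> L (Suc n) \<subseteq> L n - F n"
  proof (rule dependent_nat_choice)
    show "\<exists>L. fat L \<and> L \<subseteq> G"
      using shrink[OF G(1) \<open>G \<noteq> {}\<close>] .
  next
    fix L n assume L: "fat L \<and> L \<subseteq> G"
    then obtain V where V: "openin fine_top V" "V \<noteq> {}" "V \<subseteq> L"
      by (auto simp: fat_def)
    have "openin fine_top (V - F n)" "V - F n \<noteq> {}"
      using F[of n] V by (auto simp: fine_nowhere_dense_def intro: openin_diff)
    from shrink[OF this] show "\<exists>L'. (fat L' \<and> L' \<subseteq> G) \<and> L' \<subseteq> L - F n"
      using L V(3) by blast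
  qed
  then obtain L where L: "\<And>n. fat (L n)" "\<And>n. L n \<subseteq> G" "\<And>n. L (Suc n) \<subseteq> L n - F n"
    by blast
  have comp: "compact (L n)" and ne: "L n \<noteq> {}" for n
    using L(1)[of n] by (auto simp: fat_def)
  have dec: "L n \<subseteq> L m" if "m \<le> n" for m n
    using that
  proof (induction n rule: dec_induct)
    case (step n)
    then show ?case using L(3)[of n] by blast
  qed simp
  have "L 0 \<inter> (\<Inter>n\<in>UNIV. L n) \<noteq> {}"
  proof (rule compact_imp_fip_image[OF comp])
    show "closed (L n)" for n using comp by (rule compact_imp_closed)
    fix I :: "nat set" assume "finite I" "I \<subseteq> UNIV"
    define m where "m = Max (insert 0 I)"
    have "L m \<subseteq> L n" if "n \<in> insert 0 I" for n
      using that \<open>finite I\<close> by (intro dec) (simp add: m_def)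
    then have "L m \<subseteq> L 0 \<inter> (\<Inter>n\<in>I. L n)" by blast
    then show "L 0 \<inter> (\<Inter>n\<in>I. L n) \<noteq> {}" using ne[of m] by blast
  qed
  then obtain z where z: "\<And>n. z \<in> L n" by auto
  then have "z \<in> \<Union>(range F)" using L(2)[of 0] G(2) range_F by blast
  then show False using L(3) z by blast
qed

section \<open>Fine regularizations of infima and their exceptional sets\<close>

lemma fine_lsc_regularization_le: "fine_lsc_regularization W g x \<le> g x"
  unfolding fine_lsc_regularization_eq by (auto simp: Sup_apply le_fun_def intro!: SUP_least)

lemma fine_lsc_regularization_upper:
  "finely_lsc W h \<Longrightarrow> h \<le> g \<Longrightarrow> h x \<le> fine_lsc_regularization W g x"
  unfolding fine_lsc_regularization_eq by (rule le_funD[OF Sup_upper]) simp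

lemma fine_lsc_regularization_mono:
  "g \<le> h \<Longrightarrow> fine_lsc_regularization W g \<le> fine_lsc_regularization W h"
  unfolding fine_lsc_regularization_eq by (rule Sup_subset_mono) auto

lemma openin_fine_Collect_greater_add:
  assumes "w \<in> W"
  shows "openin fine_top {x. a < w x + ereal c}"
proof -
  have "{x. a < w x + ereal c} = w -` {y. a < y + ereal c}" by auto
  moreover have "open {y. a < y + ereal c}"
  proof (cases a)
    case (real r)
    have "{y. a < y + ereal c} = {ereal (r - c)<..}"
    proof (intro set_eqI)
      fix y show "y \<in> {y. a < y + ereal c} \<longleftrightarrow> y \<in> {ereal (r - c)<..}"
        using real by (cases y) auto
    qed
    then show ?thesis by simp
  next
    case PInf
    then show ?thesis by simp
  next
    case MInf
    have "{y. a < y + ereal c} = {-\<infinity><..}" unfolding MInf by (auto simp: less_eq_ereal_def)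
    then show ?thesis by simp
  qed
  ultimately show ?thesis
    using openin_fine_vimage[OF assms, of "{y. a < y + ereal c}"] by (simp only:)
qed

text \<open>The set is finely closed because the members of \<open>V\<close> and, by (B2), the
  regularization are finely continuous. On a nonempty finely open subset \<open>G\<close> the
  regularization could be raised by \<open>c\<close> and would still be a finely lower
  semicontinuous minorant, contradicting maximality.\<close>

lemma fine_nowhere_dense_regularization_gap:
  assumes V: "V \<subseteq> W" and "0 < c" and fin: "\<And>x. (INF v\<in>V. v x) < \<infinity>"
  defines "g \<equiv> \<lambda>x. INF v\<in>V. v x"
  shows "fine_nowhere_dense {x. fine_lsc_regularization W g x + ereal c \<le> g x}"
proof -
  define r where "r = fine_lsc_regularization W g"
  have r: "r \<in> W" using B2[OF V] by (simp add: r_def g_def)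
  have r_le: "r x \<le> g x" for x unfolding r_def by (rule fine_lsc_regularization_le)
  have "- {x. r x + ereal c \<le> g x} = (\<Union>v\<in>V. {x. v x < r x + ereal c})"
    by (auto simp: g_def le_INF_iff not_le)
  moreover have "openin fine_top {x. v x < r x + ereal c}" if "v \<in> V" for v
  proof (rule openin_fine_Collect_less)
    fix q :: real
    have "v -` {..<ereal q} = {x. v x < ereal q}" by auto
    then show "openin fine_top {x. v x < ereal q}"
      using openin_fine_vimage[of v "{..<ereal q}"] that V by auto
    show "openin fine_top {x. ereal q < r x + ereal c}"
      using r by (rule openin_fine_Collect_greater_add)
  qed
  ultimately have "closedin fine_top {x. r x + ereal c \<le> g x}"
    by (auto simp: closedin_def topspace_fine Compl_eq_Diff_UNIV[symmetric])
  moreover have "G = {}" if G: "openin fine_top G" "G \<subseteq> {x. r x + ereal c \<le> g x}" for G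
  proof (rule ccontr)
    assume "G \<noteq> {}"
    then obtain x where x: "x \<in> G" by blast
    define h where "h z = (if z \<in> G then r z + ereal c else r z)" for z
    have "finely_lsc W h"
      unfolding finely_lsc_def
    proof
      fix a
      have "{z. a < h z} = {z. a < r z + ereal 0} \<union> (G \<inter> {z. a < r z + ereal c})"
      proof -
        have "r z \<le> r z + ereal c" for z using \<open>0 < c\<close> by (cases "r z") auto
        then show ?thesis by (auto simp: h_def zero_ereal_def[symmetric] intro: less_le_trans)
      qed
      then show "openin fine_top {z. a < h z}"
        by (simp only:) (intro openin_Un openin_Int openin_fine_Collect_greater_add r G)
    qed
    moreover have "h \<le> g"
      using G(2) r_le by (auto simp: h_def le_fun_def)
    ultimately have "h x \<le> r x"
      unfolding r_def by (rule fine_lsc_regularization_upper)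
    \<comment> \<open>Finiteness is essential here: \<open>r x + c \<le> r x\<close> is
      contradictory only for finite \<open>r x\<close>.\<close>
    moreover have "\<bar>r x\<bar> \<noteq> \<infinity>"
      using nonneg[OF r, of x] r_le[of x] fin[of x] by (auto simp: g_def)
    ultimately show False
      using x \<open>0 < c\<close> by (cases "r x") (auto simp: h_def)
  qed
  ultimately show ?thesis
    by (simp add: fine_nowhere_dense_def r_def)
qed

text \<open>The functions \<open>w k\<close> are the fine regularizations of the infima of the tails of \<open>h\<close>.\<close>

lemma superharmonic_liminf:
  fixes h :: "nat \<Rightarrow> 'a \<Rightarrow> real"
  assumes h: "\<And>j. h j \<in> cont_part W"
  shows "\<exists>(w :: nat \<Rightarrow> 'a \<Rightarrow> ereal) \<F>. (\<forall>k. w k \<in> W) \<and> incseq w \<and>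
    (\<forall>k j x. k \<le> j \<longrightarrow> w k x \<le> ereal (h j x)) \<and>
    countable \<F> \<and> (\<forall>F\<in>\<F>. fine_nowhere_dense F) \<and>
    (\<forall>x l. x \<notin> \<Union>\<F> \<longrightarrow> (\<lambda>j. h j x) \<longlonglongrightarrow> l \<longrightarrow> (SUP k. w k x) = ereal l)"
proof -
  define V where "V k = (\<lambda>j x. ereal (h j x)) ` {k..}" for k
  define g where "g k x = (INF v\<in>V k. v x)" for k x
  define w where "w k = fine_lsc_regularization W (g k)" for k
  \<comment> \<open>By the Archimedean property, the gaps of size \<open>1/(m+1)\<close> together
    cover all points where some \<open>w k\<close> differs from the tail infimum \<open>g k\<close>,
    so countably many sets suffice.\<close>
  define F where "F = (\<lambda>(k, m). {x. w k x + ereal (inverse (real (Suc m))) \<le> g k x})"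
  have V: "V k \<subseteq> W" for k using h by (auto simp: V_def cont_part_def)
  have g_eq: "g k x = (INF j\<in>{k..}. ereal (h j x))" for k x
    by (simp add: g_def V_def image_comp)
  have g_le: "g k x \<le> ereal (h j x)" if "k \<le> j" for k j x
    unfolding g_eq using that by (intro INF_lower) simp
  have w_le: "w k x \<le> g k x" for k x
    unfolding w_def by (rule fine_lsc_regularization_le)
  have wW: "w k \<in> W" for k
    using B2[OF V, of k] by (simp add: w_def g_def[abs_def])
  show ?thesis
  proof (intro exI[of _ w] exI[of _ "range F"] conjI allI ballI impI)
    show "w k \<in> W" for k by (rule wW)
    show "incseq w"
      unfolding w_def g_eq
      by (intro incseq_SucI fine_lsc_regularization_mono le_funI INF_superset_mono) auto
    show "w k x \<le> ereal (h j x)" if "k \<le> j" for k j x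
      using w_le g_le[OF that] by (rule order_trans)
    show "countable (range F)" by simp
    show "fine_nowhere_dense A" if "A \<in> range F" for A
    proof -
      obtain k m where A: "A = F (k, m)" using \<open>A \<in> range F\<close> by (metis imageE prod.exhaust)
      have "g k x < \<infinity>" for x using g_le[of k k x] by (auto intro: le_less_trans)
      then show ?thesis
        using fine_nowhere_dense_regularization_gap[OF V, of "inverse (real (Suc m))" k]
        unfolding A F_def w_def by (simp add: g_def[abs_def] del: of_nat_Suc)
    qed
    fix x l assume x: "x \<notin> \<Union>(range F)" and l: "(\<lambda>j. h j x) \<longlonglongrightarrow> l"
    have "w k x = g k x" for k
    proof (rule ccontr)
      assume "w k x \<noteq> g k x"
      then have less: "w k x < g k x" using w_le[of k x] by simp
      then obtain a where a: "w k x = ereal a"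
        using nonneg[OF wW, of k x] by (cases "w k x") auto
      obtain b where b: "g k x = ereal b"
        using less g_le[of k k x] a by (cases "g k x") auto
      obtain m where "inverse (real (Suc m)) < b - a"
        using reals_Archimedean[of "b - a"] less a b by auto
      then have "x \<in> F (k, m)" by (simp add: F_def a b)
      then show False using x by blast
    qed
    then have "(SUP k. w k x) = liminf (\<lambda>j. ereal (h j x))"
      by (simp add: liminf_SUP_INF g_eq)
    also have "\<dots> = ereal l"
      using l by (intro lim_imp_Liminf) auto
    finally show "(SUP k. w k x) = ereal l" .
  qed
qed

section \<open>Uniform convergence on compact sets\<close>

text \<open>Lower semicontinuity alone controls a sequence only from below. The complementary
  sequence \<open>h' j = p - h j\<close> turns a lower bound for \<open>h'\<close> into an upper
  bound for \<open>h\<close>.\<close>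

lemma uniformly_Cauchy_on_compact:
  fixes h h' :: "nat \<Rightarrow> 'a \<Rightarrow> real"
  assumes h: "\<And>j. h j \<in> cont_part W" and h': "\<And>j. h' j \<in> cont_part W"
    and p: "p \<in> cont_part W" and sum: "\<And>j x. h j x + h' j x = p x"
    and conv: "\<And>x. convergent (\<lambda>j. h j x)" and C: "compact C" and "0 < e"
  obtains N where "\<And>i j x. N \<le> i \<Longrightarrow> N \<le> j \<Longrightarrow> x \<in> C \<Longrightarrow> \<bar>h i x - h j x\<bar> < e"
proof -
  obtain w \<F> where w: "\<And>k. w k \<in> W" "incseq w" "\<And>k j x. k \<le> j \<Longrightarrow> w k x \<le> ereal (h j x)"
    "countable \<F>" "\<And>F. F \<in> \<F> \<Longrightarrow> fine_nowhere_dense F"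
    "\<And>x l. x \<notin> \<Union>\<F> \<Longrightarrow> (\<lambda>j. h j x) \<longlonglongrightarrow> l \<Longrightarrow> (SUP k. w k x) = ereal l"
    using superharmonic_liminf[of h, OF h] by blast
  obtain w' \<F>' where w': "\<And>k. w' k \<in> W" "incseq w'" "\<And>k j x. k \<le> j \<Longrightarrow> w' k x \<le> ereal (h' j x)"
    "countable \<F>'" "\<And>F. F \<in> \<F>' \<Longrightarrow> fine_nowhere_dense F"
    "\<And>x l. x \<notin> \<Union>\<F>' \<Longrightarrow> (\<lambda>j. h' j x) \<longlonglongrightarrow> l \<Longrightarrow> (SUP k. w' k x) = ereal l"
    using superharmonic_liminf[of h', OF h'] by blast
  define s where "s k x = w k x + w' k x" for k x
  have sW: "s k \<in> W" for k
    unfolding s_def[abs_def] using w(1) w'(1) by (rule cone_add)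
  have inc: "incseq s"
    using w(2) w'(2) unfolding incseq_def le_fun_def s_def by (simp add: add_mono)
  have inc': "incseq (\<lambda>k. w k x)" "incseq (\<lambda>k. w' k x)" for x
    using w(2) w'(2) by (auto simp: incseq_def le_fun_def)
  define S where "S x = (SUP k. s k x)" for x
  have SW: "S \<in> W"
    unfolding S_def[abs_def] using sW inc by (rule B1)
  have "openin fine_top {x. S x < ereal (p x)}"
  proof (rule openin_fine_Collect_less)
    fix q :: real
    have "S -` {..<ereal q} = {x. S x < ereal q}" by auto
    then show "openin fine_top {x. S x < ereal q}"
      using openin_fine_vimage[OF SW, of "{..<ereal q}"] by simp
    show "openin fine_top {x. ereal q < ereal (p x)}"
      using openin_fine_cont_vimage[OF p, of "{q<..}"] by simp
  qed
  \<comment> \<open>Off the exceptional sets the two increasing sequences reach the limits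
    \<open>l\<close> and \<open>p x - l\<close>, whose sum is \<open>p x\<close>.\<close>
  moreover have "{x. S x < ereal (p x)} \<subseteq> \<Union>(\<F> \<union> \<F>')"
  proof (rule ccontr)
    assume "\<not> ?thesis"
    then obtain x where x: "S x < ereal (p x)" "x \<notin> \<Union>\<F>" "x \<notin> \<Union>\<F>'" by auto
    obtain l where l: "(\<lambda>j. h j x) \<longlonglongrightarrow> l" using conv by (auto simp: convergent_def)
    have h'_eq: "h' j x = p x - h j x" for j using sum[of j x] by simp
    have l': "(\<lambda>j. h' j x) \<longlonglongrightarrow> p x - l" unfolding h'_eq by (intro tendsto_intros l)
    have "S x = (SUP k. w k x) + (SUP k. w' k x)"
      unfolding S_def s_def using nonneg w(1) w'(1) by (intro SUP_ereal_add_pos inc') auto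
    also have "\<dots> = ereal (p x)"
      using w(6)[OF x(2) l] w'(6)[OF x(3) l'] by simp
    finally show False using x(1) by simp
  qed
  moreover have "countable (\<F> \<union> \<F>')" "\<And>F. F \<in> \<F> \<union> \<F>' \<Longrightarrow> fine_nowhere_dense F"
    using w(4,5) w'(4,5) by auto
  ultimately have "{x. S x < ereal (p x)} = {}"
    using fine_Baire[of "\<F> \<union> \<F>'" "{x. S x < ereal (p x)}"] by blast
  then have S_ge: "ereal (p x) \<le> S x" for x by (force simp: not_less)
  have p_cont: "continuous_on UNIV p" using p by (simp add: cont_part_def)
  define G where "G k = {x. ereal (p x - e) < s k x}" for k
  have "open (G k)" for k
    unfolding G_def by (intro open_Collect_less_superharmonic sW continuous_intros p_cont)
  moreover have "C \<subseteq> (\<Union>k\<in>UNIV. G k)"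
  proof
    fix x assume "x \<in> C"
    have "ereal (p x - e) < ereal (p x)" using \<open>0 < e\<close> by simp
    also have "\<dots> \<le> S x" by (rule S_ge)
    finally have "ereal (p x - e) < S x" .
    then show "x \<in> (\<Union>k\<in>UNIV. G k)" by (auto simp: S_def G_def less_SUP_iff)
  qed
  ultimately obtain I where I: "finite I" "C \<subseteq> (\<Union>k\<in>I. G k)"
    using compactE_image[OF C, of UNIV G] by metis
  define N where "N = Max (insert 0 I)"
  have "C \<subseteq> G N"
  proof
    fix x assume "x \<in> C"
    then obtain k where k: "k \<in> I" "x \<in> G k" using I by blast
    then have "k \<le> N" using I(1) by (simp add: N_def)
    with inc have "s k x \<le> s N x" by (auto simp: incseq_def le_fun_def)
    with k(2) show "x \<in> G N" by (auto simp: G_def intro: less_le_trans)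
  qed
  \<comment> \<open>The two tails are used at different indices:
    \<open>p x - e < h i x + h' j x\<close>, and \<open>h' j x = p x - h j x\<close> gives the
    bound.\<close>
  have lt: "h j x - h i x < e" if "N \<le> i" "N \<le> j" "x \<in> C" for i j x
  proof -
    have "ereal (p x - e) < s N x" using \<open>C \<subseteq> G N\<close> that(3) by (auto simp: G_def)
    also have "\<dots> \<le> ereal (h i x) + ereal (h' j x)"
      unfolding s_def by (intro add_mono w(3) w'(3) that)
    finally show ?thesis using sum[of j x] by simp
  qed
  show ?thesis
  proof (rule that[of N])
    fix i j x assume "N \<le> i" "N \<le> j" "x \<in> C"
    then show "\<bar>h i x - h j x\<bar> < e" using lt[of i j x] lt[of j i x] by (simp add: abs_less_iff)
  qed
qed

text \<open>\<open>w\<close> need not be continuous, but by lower semicontinuity the increasing sets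
  where \<open>w\<close> exceeds \<open>1/(n+1)\<close> are open, and they cover
  \<open>C\<close>.\<close>

lemma positive_min_on_compact:
  assumes w: "w \<in> W" "\<And>x. 0 < w x" and "compact C"
  obtains \<delta> :: real where "0 < \<delta>" "\<And>x. x \<in> C \<Longrightarrow> ereal \<delta> \<le> w x"
proof -
  define G where "G n = {x. ereal (inverse (real (Suc n))) < w x}" for n
  have "open (G n)" for n
    unfolding G_def by (intro open_Collect_less_superharmonic w continuous_on_const)
  moreover have "C \<subseteq> (\<Union>n\<in>UNIV. G n)"
  proof
    fix x assume "x \<in> C"
    obtain e :: real where e: "0 < ereal e" "ereal e < w x"
      using ereal_dense2[OF w(2)] by blast
    then obtain n where "inverse (real (Suc n)) < e"
      using reals_Archimedean[of e] by auto
    then have "ereal (inverse (real (Suc n))) < ereal e" by (simp del: of_nat_Suc)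
    also note e(2)
    finally have "x \<in> G n" by (simp add: G_def)
    then show "x \<in> (\<Union>n\<in>UNIV. G n)" by blast
  qed
  ultimately obtain I where I: "finite I" "C \<subseteq> (\<Union>n\<in>I. G n)"
    using compactE_image[OF \<open>compact C\<close>, of UNIV G] by metis
  define N where "N = Max (insert 0 I)"
  show ?thesis
  proof (rule that[of "inverse (real (Suc N))"])
    fix x assume "x \<in> C"
    then obtain n where n: "n \<in> I" "x \<in> G n" using I by blast
    then have "n \<le> N" using I(1) by (simp add: N_def)
    then have "inverse (real (Suc N)) \<le> inverse (real (Suc n))" by simp
    then have "ereal (inverse (real (Suc N))) \<le> ereal (inverse (real (Suc n)))"
      by (simp only: ereal_less_eq)
    also have "\<dots> \<le> w x" using n(2) by (simp add: G_def)
    finally show "ereal (inverse (real (Suc N))) \<le> w x" .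
  qed simp
qed

end

subsection \<open>Bounded Borel functions\<close>

lemma Bb_bounded_by:
  assumes "f \<in> borel_measurable borel" "\<And>x. \<bar>f x\<bar> \<le> c"
  shows "f \<in> Bb"
  using assms by (auto simp: Bb_def bounded_iff)

lemma Bb_boundE:
  assumes "f \<in> Bb"
  obtains c where "0 \<le> c" "\<And>x. \<bar>f x\<bar> \<le> c"
proof -
  obtain c where c: "\<And>x. \<bar>f x\<bar> \<le> c"
    using assms by (auto simp: Bb_def bounded_iff)
  then have "0 \<le> c" using abs_ge_zero[of "f undefined"] order_trans by blast
  then show ?thesis using c by (rule that)
qed

lemma Bb_measurable: "f \<in> Bb \<Longrightarrow> f \<in> borel_measurable borel"
  by (simp add: Bb_def)

lemma Bb_const: "(\<lambda>_. c) \<in> Bb"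
  by (rule Bb_bounded_by[of _ "\<bar>c\<bar>"]) auto

lemma Bb_indicator: "A \<in> sets borel \<Longrightarrow> indicat_real A \<in> Bb"
  by (rule Bb_bounded_by[of _ 1]) (auto simp: indicator_def)

lemma Bb_add:
  assumes "f \<in> Bb" "g \<in> Bb" shows "(\<lambda>x. f x + g x) \<in> Bb"
proof -
  obtain a b where "\<And>x. \<bar>f x\<bar> \<le> a" "\<And>x. \<bar>g x\<bar> \<le> b"
    using Bb_boundE[OF assms(1)] Bb_boundE[OF assms(2)] by metis
  then have "\<bar>f x + g x\<bar> \<le> a + b" for x
    by (meson abs_triangle_ineq add_mono order_trans)
  then show ?thesis
    using assms by (intro Bb_bounded_by[of _ "a + b"]) (auto simp: Bb_def)
qed

lemma Bb_mult:
  assumes "f \<in> Bb" "g \<in> Bb" shows "(\<lambda>x. f x * g x) \<in> Bb"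
proof -
  obtain a where a: "0 \<le> a" "\<And>x. \<bar>f x\<bar> \<le> a" by (rule Bb_boundE[OF assms(1)]) blast
  obtain b where b: "\<And>x. \<bar>g x\<bar> \<le> b" by (rule Bb_boundE[OF assms(2)]) blast
  have "\<bar>f x * g x\<bar> \<le> a * b" for x
    unfolding abs_mult using a b by (intro mult_mono) auto
  then show ?thesis
    using assms by (intro Bb_bounded_by[of _ "a * b"]) (auto simp: Bb_def)
qed

lemma Bb_cmult: "f \<in> Bb \<Longrightarrow> (\<lambda>x. c * f x) \<in> Bb"
  by (rule Bb_mult[OF Bb_const])

lemma Bb_diff: "f \<in> Bb \<Longrightarrow> g \<in> Bb \<Longrightarrow> (\<lambda>x. f x - g x) \<in> Bb"
  using Bb_add[OF _ Bb_cmult[of g "-1"], of f] by simp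

text \<open>Completeness is what turns total boundedness of the image of the unit ball into
  compactness of its closure.\<close>

lemma mcomplete_Bb: "Metric_space.mcomplete (Bb :: ('a::topological_space \<Rightarrow> real) set) sup_dist"
proof -
  interpret Metric_space "Bb :: ('a \<Rightarrow> real) set" sup_dist by (rule Metric_space_Bb)
  show ?thesis
    unfolding mcomplete_def
  proof (intro allI impI)
    fix \<sigma> :: "nat \<Rightarrow> 'a \<Rightarrow> real"
    assume "MCauchy \<sigma>"
    then have \<sigma>: "\<And>n. \<sigma> n \<in> Bb"
      and C: "\<And>e. 0 < e \<Longrightarrow> \<exists>N. \<forall>n m. N \<le> n \<longrightarrow> N \<le> m \<longrightarrow> sup_dist (\<sigma> n) (\<sigma> m) < e"
      by (auto simp: MCauchy_def)
    have unif: "\<exists>N. \<forall>n\<ge>N. \<forall>m\<ge>N. \<forall>x. \<bar>\<sigma> n x - \<sigma> m x\<bar> \<le> e" if e: "0 < e" for e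
    proof -
      obtain N where N: "\<And>n m. N \<le> n \<Longrightarrow> N \<le> m \<Longrightarrow> sup_dist (\<sigma> n) (\<sigma> m) < e"
        using C[OF e] by blast
      have "\<bar>\<sigma> n x - \<sigma> m x\<bar> \<le> e" if "N \<le> n" "N \<le> m" for n m x
        using sup_dist_le_iff[OF \<sigma> \<sigma>, of n m e] less_imp_le[OF N[OF that]] by blast
      then show ?thesis by blast
    qed
    define l where "l x = lim (\<lambda>n. \<sigma> n x)" for x
    have "convergent (\<lambda>n. \<sigma> n x)" for x
    proof (rule Cauchy_convergent, rule metric_CauchyI)
      fix e :: real assume "0 < e"
      then obtain N where "\<And>n m x. N \<le> n \<Longrightarrow> N \<le> m \<Longrightarrow> \<bar>\<sigma> n x - \<sigma> m x\<bar> \<le> e / 2"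
        using unif[of "e / 2"] by auto
      then have "dist (\<sigma> n x) (\<sigma> m x) \<le> e / 2" if "N \<le> n" "N \<le> m" for n m
        using that by (simp add: dist_real_def)
      moreover have "e / 2 < e" using \<open>0 < e\<close> by simp
      ultimately show "\<exists>N. \<forall>m\<ge>N. \<forall>n\<ge>N. dist (\<sigma> m x) (\<sigma> n x) < e"
        by (meson le_less_trans)
    qed
    then have l: "(\<lambda>n. \<sigma> n x) \<longlonglongrightarrow> l x" for x
      by (simp add: l_def convergent_LIMSEQ_iff)
    \<comment> \<open>Letting \<open>m\<close> tend to infinity in the Cauchy estimate preserves the
      non-strict bound, with \<open>N\<close> independent of \<open>x\<close>.\<close>
    have lim: "\<exists>N. \<forall>n\<ge>N. \<forall>x. \<bar>\<sigma> n x - l x\<bar> \<le> e" if e: "0 < e" for e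
    proof -
      obtain N where N: "\<And>n m x. N \<le> n \<Longrightarrow> N \<le> m \<Longrightarrow> \<bar>\<sigma> n x - \<sigma> m x\<bar> \<le> e"
        using unif[OF e] by blast
      have "\<bar>\<sigma> n x - l x\<bar> \<le> e" if "N \<le> n" for n x
      proof (rule Lim_bounded)
        show "(\<lambda>m. \<bar>\<sigma> n x - \<sigma> m x\<bar>) \<longlonglongrightarrow> \<bar>\<sigma> n x - l x\<bar>"
          by (intro tendsto_intros l)
        show "\<forall>m\<ge>N. \<bar>\<sigma> n x - \<sigma> m x\<bar> \<le> e" using N that by blast
      qed
      then show ?thesis by blast
    qed
    have "l \<in> Bb"
    proof -
      obtain N where N: "\<And>x. \<bar>\<sigma> N x - l x\<bar> \<le> 1" using lim[of 1] by auto
      obtain c where c: "\<And>x. \<bar>\<sigma> N x\<bar> \<le> c" by (rule Bb_boundE[OF \<sigma>[of N]]) blast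
      have "\<bar>l x\<bar> \<le> c + 1" for x using N[of x] c[of x] by linarith
      moreover have "l \<in> borel_measurable borel"
        by (rule borel_measurable_LIMSEQ_real[OF _ Bb_measurable[OF \<sigma>]]) (rule l)
      ultimately show ?thesis by (intro Bb_bounded_by)
    qed
    moreover have "\<forall>\<^sub>F n in sequentially. \<sigma> n \<in> Bb \<and> sup_dist (\<sigma> n) l < e" if "0 < e" for e
    proof -
      obtain N where N: "\<And>n x. N \<le> n \<Longrightarrow> \<bar>\<sigma> n x - l x\<bar> \<le> e / 2"
        using lim[of "e / 2"] \<open>0 < e\<close> by auto
      have "sup_dist (\<sigma> n) l < e" if "N \<le> n" for n
      proof -
        have "sup_dist (\<sigma> n) l \<le> e / 2"
          using sup_dist_le_iff[OF \<sigma> \<open>l \<in> Bb\<close>, of n "e / 2"] N[OF that] by blast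
        then show ?thesis using \<open>0 < e\<close> by linarith
      qed
      then show ?thesis using \<sigma> by (auto simp: eventually_sequentially)
    qed
    ultimately show "\<exists>x. limitin mtopology \<sigma> x sequentially"
      by (auto simp: limitin_metric)
  qed
qed

lemma sup_norm_tendsto_0_iff:
  "(\<lambda>n. sup_norm (f n)) \<longlonglongrightarrow> 0 \<longleftrightarrow> (\<forall>e>0. \<exists>N. \<forall>n\<ge>N. \<forall>x. \<bar>f n x\<bar> \<le> e)"
proof
  assume lim: "(\<lambda>n. sup_norm (f n)) \<longlonglongrightarrow> 0"
  show "\<forall>e>0. \<exists>N. \<forall>n\<ge>N. \<forall>x. \<bar>f n x\<bar> \<le> e"
  proof (intro allI impI)
    fix e :: real assume "0 < e"
    then have "eventually (\<lambda>n. sup_norm (f n) < ereal e) sequentially"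
      by (intro order_tendstoD(2)[OF lim]) auto
    then show "\<exists>N. \<forall>n\<ge>N. \<forall>x. \<bar>f n x\<bar> \<le> e"
      unfolding eventually_sequentially using less_imp_le sup_norm_le_iff by metis
  qed
next
  assume R: "\<forall>e>0. \<exists>N. \<forall>n\<ge>N. \<forall>x. \<bar>f n x\<bar> \<le> e"
  show "(\<lambda>n. sup_norm (f n)) \<longlonglongrightarrow> 0"
  proof (rule order_tendstoI)
    fix a :: ereal assume "a < 0"
    then show "\<forall>\<^sub>F n in sequentially. a < sup_norm (f n)"
      by (intro always_eventually allI less_le_trans[OF _ sup_norm_nonneg])
  next
    fix a :: ereal assume "0 < a"
    then obtain e :: real where e: "0 < ereal e" "ereal e < a"
      using ereal_dense2 by blast
    then obtain N where "\<And>n x. N \<le> n \<Longrightarrow> \<bar>f n x\<bar> \<le> e"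
      using R[rule_format, of e] by auto
    then have "sup_norm (f n) < a" if "N \<le> n" for n
      using that e(2) sup_norm_le_iff[of "f n" e] by (auto intro: le_less_trans)
    then show "\<forall>\<^sub>F n in sequentially. sup_norm (f n) < a"
      by (auto simp: eventually_sequentially)
  qed
qed

lemma is_exhaustion_measurable: "is_exhaustion U \<Longrightarrow> U n \<in> sets borel"
  by (simp add: is_exhaustion_def)

lemma is_exhaustion_mono:
  assumes "is_exhaustion U" "m \<le> n"
  shows "U m \<subseteq> U n"
  using assms(2)
proof (rule lift_Suc_mono_le[rotated])
  show "U n \<subseteq> U (Suc n)" for n
    using assms(1) closure_subset[of "U n"] unfolding is_exhaustion_def by blast
qed

subsection \<open>Potential kernels\<close>

locale potential_kernel = balayage_space W
  for W :: "('a::{t2_space, second_countable_topology} \<Rightarrow> ereal) set" +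
  fixes p :: "'a \<Rightarrow> real" and K :: "'a \<Rightarrow> 'a measure"
  assumes p: "p \<in> potentials W" and K: "is_potential_kernel W p K"
begin

lemma sets_K: "sets (K x) = sets borel"
  using K by (simp add: is_potential_kernel_def is_kernel_def)

lemma space_K: "space (K x) = UNIV"
  using sets_eq_imp_space_eq[OF sets_K] by simp

lemma p_cont_part: "p \<in> cont_part W"
  using p by (simp add: potentials_def)

lemma finite_K: "finite_measure (K x)"
  using K by (intro finite_measureI) (simp add: is_potential_kernel_def space_K)

lemma integrable_K: "f \<in> Bb \<Longrightarrow> integrable (K x) f"
proof -
  assume f: "f \<in> Bb"
  then obtain c where "\<And>x. \<bar>f x\<bar> \<le> c" by (rule Bb_boundE) blast
  moreover have "f \<in> borel_measurable (K x)"
    using Bb_measurable[OF f] measurable_cong_sets[OF sets_K refl] by blast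
  ultimately show ?thesis
    by (intro finite_measure.integrable_const_bound[OF finite_K, of _ c]) auto
qed

lemma kernel_op_add:
  "f \<in> Bb \<Longrightarrow> g \<in> Bb \<Longrightarrow> kernel_op K (\<lambda>x. f x + g x) x = kernel_op K f x + kernel_op K g x"
  by (simp add: kernel_op_def integrable_K)

lemma kernel_op_diff:
  "f \<in> Bb \<Longrightarrow> g \<in> Bb \<Longrightarrow> kernel_op K (\<lambda>x. f x - g x) x = kernel_op K f x - kernel_op K g x"
  by (simp add: kernel_op_def integrable_K)

lemma kernel_op_cmult: "kernel_op K (\<lambda>x. c * f x) x = c * kernel_op K f x"
  by (simp add: kernel_op_def)

lemma kernel_op_indicator: "A \<in> sets borel \<Longrightarrow> kernel_op K (indicat_real A) x = measure (K x) A"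
  by (simp add: kernel_op_def space_K)

lemma kernel_op_one: "kernel_op K (\<lambda>_. 1) x = p x"
  using K cont_part_nonneg[OF p_cont_part, of x]
  by (simp add: kernel_op_def space_K is_potential_kernel_def measure_def)

lemma kernel_op_mono:
  "f \<in> Bb \<Longrightarrow> g \<in> Bb \<Longrightarrow> (\<And>x. f x \<le> g x) \<Longrightarrow> kernel_op K f x \<le> kernel_op K g x"
  unfolding kernel_op_def by (intro integral_mono integrable_K)

lemma abs_kernel_op_le:
  assumes "f \<in> Bb" "g \<in> Bb" "\<And>x. \<bar>f x\<bar> \<le> g x"
  shows "\<bar>kernel_op K f x\<bar> \<le> kernel_op K g x"
proof -
  have "f x \<le> g x" "-1 * f x \<le> g x" for x using assms(3)[of x] by auto
  with kernel_op_mono[OF assms(1,2)] kernel_op_mono[OF Bb_cmult[OF assms(1)] assms(2), of "-1"]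
  have "kernel_op K f x \<le> kernel_op K g x" "kernel_op K (\<lambda>x. -1 * f x) x \<le> kernel_op K g x"
    by blast+
  then show ?thesis unfolding kernel_op_cmult by auto
qed

lemma kernel_op_cont_part:
  "f \<in> Bb \<Longrightarrow> (\<And>x. 0 \<le> f x) \<Longrightarrow> kernel_op K f \<in> cont_part W"
  using K by (simp add: is_potential_kernel_def potentials_def)

text \<open>Potential kernels give continuity directly only for nonnegative \<open>f\<close>, so
  \<open>f\<close> is shifted by a constant bound. Applied to indicators, this is the hypothesis
  \<open>cont\<close> of \<open>strong_Feller_convergent_subsequence\<close>.\<close>

lemma continuous_kernel_op:
  assumes "f \<in> Bb" shows "continuous_on UNIV (kernel_op K f)"
proof -
  obtain c where c: "0 \<le> c" "\<And>x. \<bar>f x\<bar> \<le> c" by (rule Bb_boundE[OF assms]) blast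
  have "0 \<le> f x + c" for x using c(2)[of x] by linarith
  then have "kernel_op K (\<lambda>x. f x + c) \<in> cont_part W" "kernel_op K (\<lambda>_. c) \<in> cont_part W"
    using c(1) by (auto intro!: kernel_op_cont_part Bb_add Bb_const assms)
  then have "continuous_on UNIV (\<lambda>x. kernel_op K (\<lambda>x. f x + c) x - kernel_op K (\<lambda>_. c) x)"
    by (intro continuous_on_diff) (auto simp: cont_part_def)
  moreover have "kernel_op K f = (\<lambda>x. kernel_op K (\<lambda>x. f x + c) x - kernel_op K (\<lambda>_. c) x)"
    using kernel_op_add[OF assms Bb_const] by (simp add: fun_eq_iff)
  ultimately show ?thesis by simp
qed

section \<open>Domination principle and its uniform consequences\<close>

text \<open>The superharmonic support of \<open>kernel_op K f\<close> lies in \<open>D\<close>, so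
  \<open>w\<close> is a member of the family whose infimum represents
  \<open>kernel_op K f\<close>.\<close>

lemma kernel_op_domination:
  assumes f: "f \<in> Bb" "\<And>x. 0 \<le> f x" and D: "closed D" "\<And>x. x \<notin> D \<Longrightarrow> f x = 0"
    and w: "w \<in> W" "\<And>x. x \<in> D \<Longrightarrow> ereal (kernel_op K f x) \<le> w x"
  shows "ereal (kernel_op K f x) \<le> w x"
proof -
  obtain C where C: "is_superharmonic_support W (kernel_op K f) C" "C \<subseteq> closure {x. f x \<noteq> 0}"
    using K f unfolding is_potential_kernel_def by blast
  have "closure {x. f x \<noteq> 0} \<subseteq> D"
    using D by (intro closure_minimal) auto
  then have "C \<subseteq> D" using C(2) by blast
  have "ereal (kernel_op K f x)
      = (INF w \<in> {w \<in> W. \<forall>y\<in>C. ereal (kernel_op K f y) \<le> w y}. w x)"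
    using C(1) unfolding is_superharmonic_support_def determined_on_def by blast
  also have "\<dots> \<le> w x"
    using w \<open>C \<subseteq> D\<close> by (intro INF_lower) auto
  finally show ?thesis .
qed

text \<open>Constants need not belong to \<open>W\<close>, so \<open>w\<close> replaces them:
  domination is applied to \<open>kernel_op K g + a * w\<close>, where \<open>a * w\<close> is at
  least \<open>a * \<delta>\<close> on \<open>D\<close> and at most \<open>a * c\<close>
  everywhere.\<close>

lemma kernel_op_diff_le_global:
  assumes f: "f \<in> Bb" "\<And>x. 0 \<le> f x" and g: "g \<in> Bb" "\<And>x. 0 \<le> g x"
    and D: "closed D" "\<And>x. x \<notin> D \<Longrightarrow> f x = 0"
    and w: "w \<in> W" "\<And>x. w x \<le> ereal c" "\<And>x. x \<in> D \<Longrightarrow> ereal \<delta> \<le> w x"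
    and "0 \<le> a" "\<And>x. x \<in> D \<Longrightarrow> kernel_op K f x - kernel_op K g x \<le> a * \<delta>"
  shows "kernel_op K f x - kernel_op K g x \<le> a * c"
proof -
  have "ereal (kernel_op K f x) \<le> ereal (kernel_op K g x) + ereal a * w x"
  proof (rule kernel_op_domination[OF f D])
    show "(\<lambda>x. ereal (kernel_op K g x) + ereal a * w x) \<in> W"
      using kernel_op_cont_part[OF g] \<open>0 \<le> a\<close> w(1)
      by (intro cone_add cone_scale) (auto simp: cont_part_def)
    fix y assume y: "y \<in> D"
    have "ereal (kernel_op K f y) \<le> ereal (kernel_op K g y) + ereal a * ereal \<delta>"
      using assms(11)[OF y] by simp
    also have "\<dots> \<le> ereal (kernel_op K g y) + ereal a * w y"
      using w(3)[OF y] \<open>0 \<le> a\<close> by (intro add_mono ereal_mult_left_mono) auto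
    finally show "ereal (kernel_op K f y) \<le> ereal (kernel_op K g y) + ereal a * w y" .
  qed
  also have "\<dots> \<le> ereal (kernel_op K g x) + ereal a * ereal c"
    using w(2)[of x] \<open>0 \<le> a\<close> by (intro add_mono ereal_mult_left_mono) auto
  finally show ?thesis by simp
qed

lemma bounded_kernel_op:
  assumes A: "A \<in> sets borel" "compact (closure A)"
    and w: "w \<in> W" "\<And>x. 0 < w x" "\<And>x. w x \<le> ereal c"
  obtains b where "\<And>x. kernel_op K (indicat_real A) x \<le> b"
proof -
  let ?q = "kernel_op K (indicat_real A)"
  obtain \<delta> where \<delta>: "0 < \<delta>" "\<And>x. x \<in> closure A \<Longrightarrow> ereal \<delta> \<le> w x"
    using positive_min_on_compact[OF w(1,2) A(2)] by blast
  have "compact (?q ` closure A)"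
    using continuous_kernel_op[OF Bb_indicator[OF A(1)]] A(2)
    by (intro compact_continuous_image) (auto intro: continuous_on_subset)
  then obtain b where b: "\<And>x. x \<in> closure A \<Longrightarrow> \<bar>?q x\<bar> \<le> b"
    by (metis bounded_iff compact_imp_bounded imageI real_norm_def)
  \<comment> \<open>The maximum secures \<open>0 \<le> a\<close> also for empty \<open>A\<close>,
    where nothing is known about \<open>b\<close>.\<close>
  define a where "a = max 0 b / \<delta>"
  have zero: "kernel_op K (\<lambda>_. 0) x = 0" for x by (simp add: kernel_op_def)
  have "?q x - kernel_op K (\<lambda>_. 0) x \<le> a * c" for x
  proof (rule kernel_op_diff_le_global[where D = "closure A" and \<delta> = \<delta> and w = w])
    show "indicat_real A x = 0" if "x \<notin> closure A" for x
      using that closure_subset by (auto simp: indicator_def)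
    show "?q x - kernel_op K (\<lambda>_. 0) x \<le> a * \<delta>" if "x \<in> closure A" for x
      using b[OF that] \<delta>(1) by (simp add: zero a_def)
    show "0 \<le> a" using \<delta>(1) by (simp add: a_def)
  qed (use A w \<delta> in \<open>auto intro: Bb_indicator Bb_const\<close>)
  then show ?thesis using that[of "a * c"] zero by simp
qed

text \<open>The Dini argument gives the estimate on \<open>closure A\<close>, and domination carries
  it to the whole space. The one-sided conclusion suffices, since \<open>i\<close> and
  \<open>j\<close> may be interchanged.\<close>

lemma uniformly_Cauchy_kernel_op:
  fixes g :: "nat \<Rightarrow> 'a \<Rightarrow> real"
  assumes A: "A \<in> sets borel" "compact (closure A)"
    and w: "w \<in> W" "\<And>x. 0 < w x" "\<And>x. w x \<le> ereal c"
    and g: "\<And>j. g j \<in> Bb" "\<And>j x. 0 \<le> g j x" "\<And>j x. g j x \<le> 1"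
    and conv: "\<And>x. convergent (\<lambda>j. kernel_op K (\<lambda>y. indicator A y * g j y) x)"
    and "0 < e"
  obtains N where "\<And>i j x. N \<le> i \<Longrightarrow> N \<le> j \<Longrightarrow>
    kernel_op K (\<lambda>y. indicator A y * g i y) x - kernel_op K (\<lambda>y. indicator A y * g j y) x \<le> e"
proof -
  obtain \<delta> where \<delta>: "0 < \<delta>" "\<And>x. x \<in> closure A \<Longrightarrow> ereal \<delta> \<le> w x"
    using positive_min_on_compact[OF w(1,2) A(2)] by blast
  have "0 < c"
    using w(2,3)[of undefined] by (metis ereal_less(2) less_le_trans)
  \<comment> \<open>An error below \<open>a * \<delta>\<close> on \<open>closure A\<close> becomes
    at most \<open>a * c = e\<close> globally.\<close>
  define a where "a = e / c"
  have "0 < a" using \<open>0 < e\<close> \<open>0 < c\<close> by (simp add: a_def)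
  define q where "q j y = indicator A y * g j y" for j y
  have q: "q j \<in> Bb" "0 \<le> q j x" "q j x \<le> 1" for j x
    unfolding q_def[abs_def] using g A(1)
    by (auto simp: indicator_def intro!: Bb_mult Bb_indicator[unfolded indicator_def[abs_def]])
  have "(\<lambda>y. 1 - q j y) \<in> Bb" for j
    by (intro Bb_diff Bb_const q)
  then have "kernel_op K (\<lambda>y. 1 - q j y) \<in> cont_part W" for j
    using q(3) by (intro kernel_op_cont_part) auto
  moreover have "kernel_op K (q j) x + kernel_op K (\<lambda>y. 1 - q j y) x = p x" for j x
    using kernel_op_diff[OF Bb_const q(1), of 1] kernel_op_one by simp
  moreover have "kernel_op K (q j) \<in> cont_part W" for j
    using q by (intro kernel_op_cont_part)
  moreover have "convergent (\<lambda>j. kernel_op K (q j) x)" for x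
    using conv by (simp add: q_def[abs_def])
  moreover have "0 < a * \<delta>" using \<open>0 < a\<close> \<delta>(1) by simp
  ultimately obtain N where N: "\<And>i j x. N \<le> i \<Longrightarrow> N \<le> j \<Longrightarrow> x \<in> closure A \<Longrightarrow>
      \<bar>kernel_op K (q i) x - kernel_op K (q j) x\<bar> < a * \<delta>"
    using uniformly_Cauchy_on_compact[of "\<lambda>j. kernel_op K (q j)" "\<lambda>j. kernel_op K (\<lambda>y. 1 - q j y)",
        OF _ _ p_cont_part _ _ A(2)] by metis
  have "kernel_op K (q i) x - kernel_op K (q j) x \<le> a * c" if ij: "N \<le> i" "N \<le> j" for i j x
  proof (rule kernel_op_diff_le_global[where D = "closure A" and \<delta> = \<delta> and w = w])
    show "q i x = 0" if "x \<notin> closure A" for x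
      using that closure_subset by (auto simp: q_def indicator_def)
    show "kernel_op K (q i) x - kernel_op K (q j) x \<le> a * \<delta>" if "x \<in> closure A" for x
      using N[OF ij that] by linarith
    show "0 \<le> a" using \<open>0 < a\<close> by simp
  qed (use q w \<delta> in auto)
  then show ?thesis
    using that[of N] \<open>0 < c\<close> unfolding q_def[abs_def] a_def by auto
qed

lemma kernel_op_Bb:
  assumes "p \<in> Bb" "f \<in> Bb"
  shows "kernel_op K f \<in> Bb"
proof -
  obtain b where b: "0 \<le> b" "\<And>x. \<bar>f x\<bar> \<le> b" by (rule Bb_boundE[OF assms(2)]) blast
  obtain c where c: "0 \<le> c" "\<And>x. \<bar>p x\<bar> \<le> c" by (rule Bb_boundE[OF assms(1)]) blast
  have "\<bar>kernel_op K f x\<bar> \<le> b * c" for x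
  proof -
    have "\<bar>kernel_op K f x\<bar> \<le> kernel_op K (\<lambda>_. b) x"
      using assms(2) b by (intro abs_kernel_op_le Bb_const)
    also have "\<dots> = b * p x"
      using kernel_op_cmult[of b "\<lambda>_. 1" x] by (simp add: kernel_op_one)
    also have "\<dots> \<le> b * c"
      using c(2)[of x] b(1) by (intro mult_left_mono) auto
    finally show ?thesis .
  qed
  then show ?thesis
    using borel_measurable_continuous_onI[OF continuous_kernel_op[OF assms(2)]]
    by (intro Bb_bounded_by)
qed

section \<open>Compactness forces vanishing tails\<close>

lemma compact_operator_imp_tail_tendsto_0:
  assumes T: "compact_operator_Bb (kernel_op K)" and U: "is_exhaustion U"
  shows "(\<lambda>n. sup_norm (kernel_op K (indicat_real (UNIV - U n)))) \<longlonglongrightarrow> 0"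
proof -
  interpret Bb: Metric_space "Bb :: ('a \<Rightarrow> real) set" sup_dist by (rule Metric_space_Bb)
  define S where "S = kernel_op K ` {f \<in> Bb. sup_norm f \<le> 1}"
  define g where "g n = kernel_op K (indicat_real (UNIV - U n))" for n
  have UB: "UNIV - U n \<in> sets borel" for n
    using is_exhaustion_measurable[OF U] by auto
  have g_eq: "g n x = measure (K x) (UNIV - U n)" for n x
    using kernel_op_indicator[OF UB] by (simp add: g_def)
  have S_Bb: "S \<subseteq> Bb" using T by (auto simp: S_def compact_operator_Bb_def)
  have "sup_norm (indicat_real (UNIV - U n)) \<le> ereal 1" for n
    by (subst sup_norm_le_iff) (simp add: indicator_def)
  then have gS: "g n \<in> S" for n
    using Bb_indicator[OF UB] by (auto simp: S_def g_def one_ereal_def)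
  then have gBb: "g n \<in> Bb" for n using S_Bb by blast
  have "range g \<subseteq> Bb.mtopology closure_of S"
    using gS closure_of_subset[of S Bb.mtopology] S_Bb by auto
  moreover have "compactin Bb.mtopology (Bb.mtopology closure_of S)"
    using T by (simp add: compact_operator_Bb_def S_def)
  ultimately obtain l r where lr: "strict_mono (r :: nat \<Rightarrow> nat)"
    "limitin Bb.mtopology (g \<circ> r) l sequentially"
    unfolding Bb.compactin_sequentially by blast
  have l: "l \<in> Bb" using lr(2) by (simp add: Bb.limitin_metric)
  have unif: "\<exists>N. \<forall>n\<ge>N. \<forall>x. \<bar>g (r n) x - l x\<bar> \<le> e" if "0 < e" for e
  proof -
    have "\<forall>\<^sub>F n in sequentially. g (r n) \<in> Bb \<and> sup_dist (g (r n)) l < e"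
      using lr(2) \<open>0 < e\<close> by (simp add: Bb.limitin_metric)
    then obtain N where N: "\<And>n. N \<le> n \<Longrightarrow> sup_dist (g (r n)) l \<le> e"
      unfolding eventually_sequentially using less_imp_le by blast
    then show ?thesis using sup_dist_le_iff[OF gBb l] by blast
  qed
  \<comment> \<open>Uniform convergence identifies \<open>l\<close> with the pointwise limit, which
    is 0 because the finite measure \<open>K x\<close> is continuous from above and the sets
    \<open>UNIV - U n\<close> decrease to the empty set.\<close>
  have "l x = 0" for x
  proof (rule LIMSEQ_unique)
    show "(\<lambda>n. g (r n) x) \<longlonglongrightarrow> l x"
    proof (rule LIMSEQ_I)
      fix e :: real assume "0 < e"
      then obtain N where N: "\<forall>n\<ge>N. \<forall>x. \<bar>g (r n) x - l x\<bar> \<le> e / 2"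
        using unif[of "e / 2"] by auto
      have "norm (g (r n) x - l x) < e" if "N \<le> n" for n
        using N[rule_format, OF that, of x] \<open>0 < e\<close> unfolding real_norm_def by linarith
      then show "\<exists>N. \<forall>n\<ge>N. norm (g (r n) x - l x) < e" by blast
    qed
    have "decseq (\<lambda>n. UNIV - U n)"
      using is_exhaustion_mono[OF U] by (auto simp: decseq_def)
    then have "(\<lambda>n. measure (K x) (UNIV - U n)) \<longlonglongrightarrow> measure (K x) (\<Inter>n. UNIV - U n)"
      using UB by (intro finite_measure.finite_Lim_measure_decseq[OF finite_K]) (auto simp: sets_K)
    moreover have "(\<Inter>n. UNIV - U n) = {}" using U by (auto simp: is_exhaustion_def)
    ultimately have "(\<lambda>n. g n x) \<longlonglongrightarrow> 0" by (simp only: g_eq measure_empty)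
    from LIMSEQ_subseq_LIMSEQ[OF this lr(1)] show "(\<lambda>n. g (r n) x) \<longlonglongrightarrow> 0"
      by (simp add: o_def)
  qed
  with unif have unif0: "\<exists>N. \<forall>n\<ge>N. \<forall>x. \<bar>g (r n) x\<bar> \<le> e" if "0 < e" for e
    using that by simp
  \<comment> \<open>As \<open>g n\<close> decreases in \<open>n\<close>, a single small member
    \<open>g (r N)\<close> of the subsequence bounds all later functions.\<close>
  have "\<exists>N. \<forall>n\<ge>N. \<forall>x. \<bar>g n x\<bar> \<le> e" if e: "0 < e" for e
  proof -
    obtain N where N: "\<And>x. \<bar>g (r N) x\<bar> \<le> e" using unif0[OF e] by blast
    have "\<bar>g n x\<bar> \<le> e" if "r N \<le> n" for n x
    proof -
      have "UNIV - U n \<subseteq> UNIV - U (r N)"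
        using is_exhaustion_mono[OF U that] by blast
      then have "g n x \<le> g (r N) x"
        unfolding g_eq using UB
        by (intro finite_measure.finite_measure_mono[OF finite_K]) (auto simp: sets_K)
      moreover have "0 \<le> g n x" by (simp add: g_eq)
      ultimately show ?thesis using N[of x] by linarith
    qed
    then show ?thesis by blast
  qed
  then show ?thesis by (simp add: sup_norm_tendsto_0_iff g_def)
qed

section \<open>Vanishing tails force compactness\<close>

text \<open>A priori \<open>p\<close> is only continuous. Splitting the constant 1 at some
  \<open>U n\<close> leaves a tail bounded by 1 and a part over a relatively compact set, which is
  bounded by domination.\<close>

lemma bounded_potential:
  assumes U: "is_exhaustion U"
    and w: "w \<in> W" "\<And>x. 0 < w x" "\<And>x. w x \<le> ereal c"
    and tail: "(\<lambda>n. sup_norm (kernel_op K (indicat_real (UNIV - U n)))) \<longlonglongrightarrow> 0"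
  shows "p \<in> Bb"
proof -
  obtain n where n: "\<And>x. \<bar>kernel_op K (indicat_real (UNIV - U n)) x\<bar> \<le> 1"
    using tail[unfolded sup_norm_tendsto_0_iff, rule_format, of 1] by auto
  have Un: "U n \<in> sets borel" "compact (closure (U n))"
    using U by (auto simp: is_exhaustion_def)
  obtain b where b: "\<And>x. kernel_op K (indicat_real (U n)) x \<le> b"
    by (rule bounded_kernel_op[OF Un w]) blast
  have "\<bar>p x\<bar> \<le> b + 1" for x
  proof -
    have "(\<lambda>x. indicat_real (U n) x + indicat_real (UNIV - U n) x) = (\<lambda>_. 1)"
      by (auto simp: indicator_def)
    then have "p x = kernel_op K (indicat_real (U n)) x + kernel_op K (indicat_real (UNIV - U n)) x"
      using kernel_op_add[of "indicat_real (U n)" "indicat_real (UNIV - U n)" x] Un(1)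
      by (simp add: Bb_indicator kernel_op_one)
    then show ?thesis
      using n[of x] b[of x] cont_part_nonneg[OF p_cont_part, of x] by linarith
  qed
  moreover have "p \<in> borel_measurable borel"
    using p_cont_part by (auto simp: cont_part_def intro: borel_measurable_continuous_onI)
  ultimately show ?thesis by (intro Bb_bounded_by)
qed

text \<open>A subsequence for which the images converge pointwise, simultaneously for all
  restrictions to the sets \<open>U n\<close>, converges uniformly up to the small tails.\<close>

lemma kernel_op_Cauchy_subsequence:
  fixes f :: "nat \<Rightarrow> 'a \<Rightarrow> real"
  assumes U: "is_exhaustion U"
    and w: "w \<in> W" "\<And>x. 0 < w x" "\<And>x. w x \<le> ereal c"
    and tail: "(\<lambda>n. sup_norm (kernel_op K (indicat_real (UNIV - U n)))) \<longlonglongrightarrow> 0"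
    and f: "\<And>j. f j \<in> Bb" "\<And>j x. \<bar>f j x\<bar> \<le> 1"
  shows "\<exists>r :: nat \<Rightarrow> nat. strict_mono r \<and>
    (\<forall>e>0. \<exists>N. \<forall>i\<ge>N. \<forall>j\<ge>N. \<forall>x. \<bar>kernel_op K (f (r i)) x - kernel_op K (f (r j)) x\<bar> \<le> e)"
proof -
  \<comment> \<open>Moves the values from \<open>[-1, 1]\<close> to \<open>[0, 1]\<close>, so that
    the kernel images lie in \<open>W\<close>; the factor 2 returns in the final estimate.\<close>
  define g where "g j x = (1 + f j x) / 2" for j x
  have "g j \<in> Bb" for j
    using Bb_cmult[OF Bb_add[OF Bb_const[of 1] f(1)], of "1/2" j] by (simp add: g_def[abs_def])
  moreover have "0 \<le> g j x" "g j x \<le> 1" for j x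
    using f(2)[of j x] by (auto simp: g_def)
  ultimately have g: "g j \<in> Bb" "0 \<le> g j x" "g j x \<le> 1" for j x by blast+
  have cont: "continuous_on UNIV (\<lambda>x. measure (K x) A)" if "A \<in> sets borel" for A
    using continuous_kernel_op[OF Bb_indicator[OF that]] kernel_op_indicator[OF that]
    by (simp cong: continuous_on_cong)
  have g_abs: "\<bar>g j x\<bar> \<le> 1" for j x using g(2,3)[of j x] by simp
  obtain r where r: "strict_mono (r :: nat \<Rightarrow> nat)"
    and conv: "\<And>x A. A \<in> sets borel \<Longrightarrow> convergent (\<lambda>j. \<integral>y. indicator A y * g (r j) y \<partial>K x)"
    by (rule strong_Feller_convergent_subsequence[of K g, OF sets_K finite_K cont Bb_measurable[OF g(1)] g_abs])
      blast+
  have "\<exists>N. \<forall>i\<ge>N. \<forall>j\<ge>N. \<forall>x. \<bar>kernel_op K (f (r i)) x - kernel_op K (f (r j)) x\<bar> \<le> e"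
    if "0 < e" for e
  proof -
    have "0 < e / 4" using that by simp
    with tail[unfolded sup_norm_tendsto_0_iff] obtain n where
      n: "\<And>x. \<bar>kernel_op K (indicat_real (UNIV - U n)) x\<bar> \<le> e / 4"
      by blast
    have Un: "U n \<in> sets borel" "compact (closure (U n))"
      using U by (auto simp: is_exhaustion_def)
    define q where "q j y = indicator (U n) y * g (r j) y" for j y
    have q: "q j \<in> Bb" for j
      unfolding q_def by (intro Bb_mult Bb_indicator Un g)
    obtain N where N: "\<And>i j x. N \<le> i \<Longrightarrow> N \<le> j \<Longrightarrow>
        kernel_op K (q i) x - kernel_op K (q j) x \<le> e / 4"
      unfolding q_def[abs_def]
      by (rule uniformly_Cauchy_kernel_op[OF Un w, of "\<lambda>j. g (r j)" "e / 4"])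
        (use g conv[OF Un(1)] \<open>0 < e / 4\<close> in \<open>auto simp: kernel_op_def\<close>)
    have "kernel_op K (f (r i)) x - kernel_op K (f (r j)) x \<le> e" if "N \<le> i" "N \<le> j" for i j x
    proof -
      \<comment> \<open>The part of the difference living outside \<open>U n\<close>. It is bounded
        by the tail indicator, and with the factor 2 from \<open>g\<close> the two errors
        \<open>e / 4\<close> add up to \<open>e\<close>.\<close>
      define d where "d y = (g (r i) y - g (r j) y) - (q i y - q j y)" for y
      have d: "d \<in> Bb" unfolding d_def by (intro Bb_diff g q)
      have d_le: "\<bar>d y\<bar> \<le> indicator (UNIV - U n) y" for y
        using g(2,3)[of "r i" y] g(2,3)[of "r j" y] by (auto simp: d_def q_def indicator_def)
      have "f (r i) y - f (r j) y = 2 * ((q i y - q j y) + d y)" for y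
        by (simp add: d_def g_def field_simps)
      then have "(\<lambda>y. f (r i) y - f (r j) y) = (\<lambda>y. 2 * ((q i y - q j y) + d y))"
        by (rule ext)
      with kernel_op_diff[OF f(1) f(1), of "r i" "r j" x]
      have "kernel_op K (f (r i)) x - kernel_op K (f (r j)) x
          = kernel_op K (\<lambda>y. 2 * ((q i y - q j y) + d y)) x"
        by (simp only:)
      also have "\<dots> = 2 * ((kernel_op K (q i) x - kernel_op K (q j) x) + kernel_op K d x)"
        unfolding kernel_op_cmult using kernel_op_add[OF Bb_diff[OF q q] d] kernel_op_diff[OF q q]
        by simp
      also have "\<dots> \<le> 2 * (e / 4 + e / 4)"
      proof -
        have "\<bar>kernel_op K d x\<bar> \<le> kernel_op K (indicat_real (UNIV - U n)) x"
          using Un(1) d_le by (intro abs_kernel_op_le d Bb_indicator) auto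
        then show ?thesis using n[of x] N[OF that, of x] by simp
      qed
      finally show ?thesis by simp
    qed
    then show ?thesis
      by (intro exI[of _ N] allI impI abs_leI) (simp_all add: minus_diff_eq)
  qed
  with r show ?thesis by blast
qed

lemma tail_tendsto_0_imp_compact_operator:
  assumes U: "is_exhaustion U"
    and w: "w \<in> W" "\<And>x. 0 < w x" "\<And>x. w x \<le> ereal c"
    and tail: "(\<lambda>n. sup_norm (kernel_op K (indicat_real (UNIV - U n)))) \<longlonglongrightarrow> 0"
  shows "compact_operator_Bb (kernel_op K)" "kernel_op K ` Bb \<subseteq> Cb"
proof -
  interpret Bb: Metric_space "Bb :: ('a \<Rightarrow> real) set" sup_dist by (rule Metric_space_Bb)
  have pBb: "p \<in> Bb" by (rule bounded_potential[OF U w tail])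
  have T: "kernel_op K ` Bb \<subseteq> Bb" using kernel_op_Bb[OF pBb] by blast
  then show "kernel_op K ` Bb \<subseteq> Cb"
    using continuous_kernel_op by (auto simp: Cb_def Bb_def)
  define B where "B = {f :: 'a \<Rightarrow> real. f \<in> Bb \<and> sup_norm f \<le> 1}"
  have B: "f \<in> Bb" "\<bar>f x\<bar> \<le> 1" if "f \<in> B" for f x
    using that sup_norm_le_iff[of f 1] by (auto simp: B_def one_ereal_def)
  \<comment> \<open>Total boundedness is checked through Cauchy subsequences, so no limit function
    has to be identified.\<close>
  have "Bb.mtotally_bounded (kernel_op K ` B)"
    unfolding Bb.mtotally_bounded_sequentially
  proof (intro conjI allI impI)
    show "kernel_op K ` B \<subseteq> Bb" using T B(1) by blast
    fix \<sigma> :: "nat \<Rightarrow> 'a \<Rightarrow> real"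
    assume "range \<sigma> \<subseteq> kernel_op K ` B"
    then have "\<forall>j. \<exists>f\<in>B. \<sigma> j = kernel_op K f" by blast
    then obtain f where f: "\<And>j. f j \<in> B" "\<And>j. \<sigma> j = kernel_op K (f j)"
      using choice[of "\<lambda>j f. f \<in> B \<and> \<sigma> j = kernel_op K f"] by blast
    from kernel_op_Cauchy_subsequence[of U w c f, OF U w tail B(1)[OF f(1)] B(2)[OF f(1)], folded f(2)]
    obtain r where r: "strict_mono (r :: nat \<Rightarrow> nat)" and
      C: "\<forall>e>0. \<exists>N. \<forall>i\<ge>N. \<forall>j\<ge>N. \<forall>x. \<bar>\<sigma> (r i) x - \<sigma> (r j) x\<bar> \<le> e"
      by blast
    have \<sigma>: "\<sigma> j \<in> Bb" for j using T B(1) f by blast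
    have "\<exists>N. \<forall>i j. N \<le> i \<longrightarrow> N \<le> j \<longrightarrow> sup_dist (\<sigma> (r i)) (\<sigma> (r j)) < e" if "0 < e" for e
    proof -
      have "0 < e / 2" using that by simp
      with C obtain N where N: "\<forall>i\<ge>N. \<forall>j\<ge>N. \<forall>x. \<bar>\<sigma> (r i) x - \<sigma> (r j) x\<bar> \<le> e / 2" by blast
      have "sup_dist (\<sigma> (r i)) (\<sigma> (r j)) < e" if "N \<le> i" "N \<le> j" for i j
      proof -
        have "sup_dist (\<sigma> (r i)) (\<sigma> (r j)) \<le> e / 2"
          using sup_dist_le_iff[OF \<sigma> \<sigma>, of "r i" "r j" "e / 2"] N that by blast
        then show ?thesis using \<open>0 < e\<close> by linarith
      qed
      then show ?thesis by blast
    qed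
    then have "Bb.MCauchy (\<sigma> \<circ> r)"
      unfolding Bb.MCauchy_def using \<sigma> by auto
    with r show "\<exists>r. strict_mono r \<and> Bb.MCauchy (\<sigma> \<circ> r)" by blast
  qed
  then have "compactin Bb.mtopology (Bb.mtopology closure_of (kernel_op K ` B))"
    using Bb.mtotally_bounded_eq_compact_closure_of[OF mcomplete_Bb] by blast
  then show "compact_operator_Bb (kernel_op K)"
    unfolding compact_operator_Bb_def B_def
    using T kernel_op_add kernel_op_cmult by (auto simp: fun_eq_iff)
qed

end

theorem theorem4p3:
  fixes W :: "('a::{t2_space, second_countable_topology} \<Rightarrow> ereal) set"
    and w0 :: "'a \<Rightarrow> ereal"
    and U :: "nat \<Rightarrow> 'a set"
    and p :: "'a \<Rightarrow> real"
    and K :: "'a \<Rightarrow> 'a measure"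
  assumes "balayage_space W"
    and "w0 \<in> W" and "\<forall>x. 0 < w0 x" and "\<exists>c::real. \<forall>x. w0 x \<le> ereal c"
    and "is_exhaustion U"
    and "p \<in> potentials W"
    and "is_potential_kernel W p K"
  shows "(compact_operator_Bb (kernel_op K) \<longleftrightarrow>
           (\<lambda>n. sup_norm (kernel_op K (indicat_real (UNIV - U n)))) \<longlonglongrightarrow> 0)
       \<and> (compact_operator_Bb (kernel_op K) \<and> kernel_op K ` Bb \<subseteq> Cb \<longleftrightarrow>
           (\<lambda>n. sup_norm (kernel_op K (indicat_real (UNIV - U n)))) \<longlonglongrightarrow> 0)"
proof -
  interpret potential_kernel W p K
    using assms by (simp add: potential_kernel_def potential_kernel_axioms_def)
  obtain c where c: "\<And>x. w0 x \<le> ereal c" using assms(4) by blast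
  have w0_pos: "\<And>x. 0 < w0 x" using assms(3) by blast
  note bwd = tail_tendsto_0_imp_compact_operator[OF assms(5,2) w0_pos c]
  show ?thesis
    using compact_operator_imp_tail_tendsto_0[OF _ assms(5)] bwd by blast
qed

end
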